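(* There is a pair $\mathfrak{K}$ of (non-isomorphic) computable structures such that $\mathfrak{K}$ is learnable, but $\mathfrak{K}$ is not learnable by a computable learner.
   Context: Structures. All structures considered are in a relational signature, i.e. a signature with no function symbols (the members of a family share one signature), and have as domain the set $\omega$ of natural numbers. A structure is identified with its atomic diagram (the collection of atomic formulas true of it), regarded via a Gödel numbering as a subset of $\omega$; it is computable if this set is computable. Two structures are copies of each other if they are isomorphic. For a structure $\mathcal{S}$ and $n\in\omega$, $\mathcal{S}\restriction_n$ denotes the finite substructure obtained by restricting $\mathcal{S}$ to the domain $\{0,1,\ldots,n\}$. Learning. Let $\mathfrak{K}$ be a finite family of pairwise non-isomorphic computable structures. - The learning domain is the collection of all copies of the structures from $\mathfrak{K}$: $\mathrm{LD}(\mathfrak{K})=\bigcup_{\mathcal{A}\in\mathfrak{K}}\{\mathcal{S} : \mathcal{S}\cong\mathcal{A}\}$. - The hypothesis space is $\mathrm{HS}(\mathfrak{K})=\{\ulcorner\mathcal{A}\urcorner : \mathcal{A}\in\mathfrak{K}\}\cup\{?\}$, which contains one formal symbol $\ulcorner\mathcal{A}\urcorner$ for each $\mathcal{A}\in\mathfrak{K}$ (a conjecture about the isomorphism type of the observed structure) and a question mark symbol. - A learner sees, by stages, all positive and negative data about a given structure in the learning domain and outputs conjectures; formally, it is a function $M$ from $\{\mathcal{S}\restriction_n : \mathcal{S}\in\mathrm{LD}(\mathfrak{K}),\ n\in\omega\}$ to $\mathrm{HS}(\mathfrak{K})$. In general $M$ can be a function of any complexity. - $M$ learns $\mathfrak{K}$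 if for every $\mathcal{S}\in\mathrm{LD}(\mathfrak{K})$ and every $\mathcal{A}\in\mathfrak{K}$: $\lim_{n\to\infty}M(\mathcal{S}\restriction_n)=\ulcorner\mathcal{A}\urcorner$ (i.e. $M(\mathcal{S}\restriction_n)=\ulcorner\mathcal{A}\urcorner$ for all sufficiently large $n$) if and only if $\mathcal{S}$ is a copy of $\mathcal{A}$. - $\mathfrak{K}$ is learnable if some learner learns $\mathfrak{K}$; it is learnable by a computable learner if some learner that learns $\mathfrak{K}$ is a computable function. *)

theory Defs
  imports Complex_Main "HOL-Library.FuncSet" "HOL-Library.Nat_Bijection"
begin

section \<open>Computability\<close>

text \<open>
  Kleene's partial recursive functions on the natural numbers. Functions of several arguments are
  treated as unary functions via the pairing function \<^const>\<open>prod_encode\<close>, and \<^const>\<open>None\<close>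
  means that the computation diverges. The last three rules are composition, primitive recursion
  and unbounded minimisation; all of them are strict, i.e. they diverge as soon as a value that is
  needed diverges.
\<close>

inductive partial_recursive :: "(nat \<Rightarrow> nat option) \<Rightarrow> bool" where
  zero: "partial_recursive (\<lambda>x. Some 0)"
| succ: "partial_recursive (\<lambda>x. Some (Suc x))"
| left: "partial_recursive (\<lambda>x. Some (fst (prod_decode x)))"
| right: "partial_recursive (\<lambda>x. Some (snd (prod_decode x)))"
| pair: "partial_recursive f \<Longrightarrow> partial_recursive g \<Longrightarrow>
    partial_recursive
      (\<lambda>x. Option.bind (f x) (\<lambda>y. Option.bind (g x) (\<lambda>z. Some (prod_encode (y, z)))))"
| comp: "partial_recursive f \<Longrightarrow> partial_recursive g \<Longrightarrow>
    partial_recursive (\<lambda>x. Option.bind (g x) f)"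
| prec: "partial_recursive f \<Longrightarrow> partial_recursive g \<Longrightarrow>
    partial_recursive
      (\<lambda>x. case prod_decode x of (a, n) \<Rightarrow>
         rec_nat (f a)
           (\<lambda>k r. Option.bind r (\<lambda>v. g (prod_encode (a, prod_encode (k, v))))) n)"
| mu: "partial_recursive f \<Longrightarrow>
    partial_recursive
      (\<lambda>a. if \<exists>n. f (prod_encode (a, n)) = Some 0 \<and>
                (\<forall>m<n. \<exists>v. f (prod_encode (a, m)) = Some (Suc v))
           then Some (LEAST n. f (prod_encode (a, n)) = Some 0)
           else None)"

definition computable_set :: "nat set \<Rightarrow> bool" where
  "computable_set X \<longleftrightarrow> partial_recursive (\<lambda>n. Some (if n \<in> X then 1 else 0))"


section \<open>Relational structures\<close>

text \<open>
  A relational signature is the list of the arities of its relation symbols, the symbols being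
  the indices into the list. It is finite, so that a restriction of a structure to an initial
  segment of the natural numbers is a finite object and has a Goedel number.
\<close>

type_synonym signature = "nat list"

datatype "structure" = Structure (univ: "nat set") (rel: "nat \<Rightarrow> nat list set")

definition omega_structure :: "signature \<Rightarrow> structure \<Rightarrow> bool" where
  "omega_structure sig S \<longleftrightarrow>
     univ S = UNIV \<and> (\<forall>i. \<forall>xs\<in>rel S i. i < length sig \<and> length xs = sig ! i)"

definition iso :: "structure \<Rightarrow> structure \<Rightarrow> bool" where
  "iso S T \<longleftrightarrow>
     (\<exists>h. bij_betw h (univ S) (univ T) \<and>
          (\<forall>i. \<forall>xs\<in>lists (univ S). xs \<in> rel S i \<longleftrightarrow> map h xs \<in> rel T i))"

text \<open>The substructure with domain \<open>{0, \<dots>, n}\<close>; note that \<open>n\<close> is included.\<close>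

definition initial_part :: "structure \<Rightarrow> nat \<Rightarrow> structure" where
  "initial_part S n = Structure {..n} (\<lambda>i. {xs \<in> rel S i. set xs \<subseteq> {..n}})"

datatype atom = Eq nat nat | Rel nat "nat list"

definition atomic_diagram :: "structure \<Rightarrow> atom set" where
  "atomic_diagram S = {Eq a a | a. a \<in> univ S} \<union> {Rel i xs | i xs. xs \<in> rel S i}"

fun atom_code :: "atom \<Rightarrow> nat" where
  "atom_code (Eq a b) = sum_encode (Inl (prod_encode (a, b)))"
| "atom_code (Rel i xs) = sum_encode (Inr (prod_encode (i, list_encode xs)))"

definition computable_structure :: "structure \<Rightarrow> bool" where
  "computable_structure S \<longleftrightarrow> computable_set (atom_code ` atomic_diagram S)"

text \<open>
  The Goedel number of a finite structure is the canonical index of its atomic diagram. The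
  domain can be read off the equations in the diagram, and the negative facts are those atomic
  formulas over the domain that are missing.
\<close>

definition structure_code :: "structure \<Rightarrow> nat" where
  "structure_code F = set_encode (atom_code ` atomic_diagram F)"

lemma inj_atom_code: "inj atom_code"
proof (rule injI)
  show "x = y" if "atom_code x = atom_code y" for x y
    using that by (cases x; cases y) (auto simp: sum_encode_eq prod_encode_eq list_encode_eq)
qed

lemma finite_atomic_diagram_initial_part:
  assumes "omega_structure sig S"
  shows "finite (atomic_diagram (initial_part S n))"
proof -
  let ?L = "{xs. set xs \<subseteq> {..n} \<and> length xs \<le> Max (insert 0 (set sig))}"
  have "atomic_diagram (initial_part S n) \<subseteq>
      (\<lambda>a. Eq a a) ` {..n} \<union> (\<lambda>(i, xs). Rel i xs) ` ({..<length sig} \<times> ?L)"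
    using assms by (fastforce simp: atomic_diagram_def initial_part_def omega_structure_def)
  moreover have "finite ?L"
    by (rule finite_lists_length_le) simp
  ultimately show ?thesis
    by (meson finite_SigmaI finite_UnI finite_atMost finite_imageI finite_lessThan finite_subset)
qed

lemma structure_code_inject:
  assumes "finite (atomic_diagram F)" "finite (atomic_diagram G)"
    and "structure_code F = structure_code G"
  shows "F = G"
proof -
  have eq: "atomic_diagram F = atomic_diagram G"
    using assms inj_atom_code
    by (simp add: structure_code_def set_encode_eq inj_image_eq_iff)
  have univ: "univ H = {a. Eq a a \<in> atomic_diagram H}" for H
    by (auto simp: atomic_diagram_def)
  have rel: "rel H = (\<lambda>i. {xs. Rel i xs \<in> atomic_diagram H})" for H
    by (auto simp: atomic_diagram_def)
  show ?thesis
    by (rule structure.expand) (simp only: univ[of F] univ[of G] rel[of F] rel[of G] eq)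
qed


section \<open>Learning\<close>

definition computable_family :: "signature \<Rightarrow> structure set \<Rightarrow> bool" where
  "computable_family sig K \<longleftrightarrow>
     finite K \<and>
     (\<forall>A\<in>K. omega_structure sig A \<and> computable_structure A) \<and>
     (\<forall>A\<in>K. \<forall>B\<in>K. A \<noteq> B \<longrightarrow> \<not> iso A B)"

definition learning_domain :: "signature \<Rightarrow> structure set \<Rightarrow> structure set" where
  "learning_domain sig K = (\<Union>A\<in>K. {S. omega_structure sig S \<and> iso S A})"

text \<open>\<^term>\<open>Some A\<close> is the formal symbol for \<open>A\<close>, and \<^const>\<open>None\<close> is the question mark.\<close>

type_synonym hypothesis = "structure option"

definition hypothesis_space :: "structure set \<Rightarrow> hypothesis set" where
  "hypothesis_space K = Some ` K \<union> {None}"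

definition observations :: "signature \<Rightarrow> structure set \<Rightarrow> structure set" where
  "observations sig K = {initial_part S n | S n. S \<in> learning_domain sig K}"

definition learns ::
  "signature \<Rightarrow> structure set \<Rightarrow> (structure \<Rightarrow> hypothesis) \<Rightarrow> bool" where
  "learns sig K M \<longleftrightarrow>
     M \<in> observations sig K \<rightarrow> hypothesis_space K \<and>
     (\<forall>S\<in>learning_domain sig K. \<forall>A\<in>K.
        (\<forall>\<^sub>F n in sequentially. M (initial_part S n) = Some A) \<longleftrightarrow> iso S A)"

text \<open>
  The values of a learner outside \<^const>\<open>observations\<close> are irrelevant, and a program for it may
  behave arbitrarily there. The formal symbols of the hypothesis space are numbered by \<open>c\<close>; as the
  hypothesis space is finite, it does not matter which numbering is used.
\<close>

definition computable_learner ::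
  "signature \<Rightarrow> structure set \<Rightarrow> (structure \<Rightarrow> hypothesis) \<Rightarrow> bool" where
  "computable_learner sig K M \<longleftrightarrow>
     (\<exists>p c. partial_recursive p \<and> inj_on c (hypothesis_space K) \<and>
        (\<forall>F\<in>observations sig K. p (structure_code F) = Some (c (M F) :: nat)))"

definition learnable :: "signature \<Rightarrow> structure set \<Rightarrow> bool" where
  "learnable sig K \<longleftrightarrow> (\<exists>M. learns sig K M)"

definition computably_learnable :: "signature \<Rightarrow> structure set \<Rightarrow> bool" where
  "computably_learnable sig K \<longleftrightarrow> (\<exists>M. learns sig K M \<and> computable_learner sig K M)"

end

(*
  Let X be a noncomputable c.e. set. Both structures consist of hubs carrying sets of labels, where
  only positive information about the labels is visible in finite parts. The first structure has
  a hub with label set X, the second one has a hub with label set {1}, and apart from that both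
  have the same hubs, whose label sets are neither subsets of X nor of {1}. A learner with access
  to X looks for the first hub that has so far shown only labels in X, or only the label 1.

  A computable learner M for the pair would make X decidable. By a locking argument some finite
  part of a copy of the first structure forces M to conjecture the first structure on all finite
  extensions inside copies of the first structure. For each n, there is computably in n a copy of
  the second structure that extends this finite part and in which the hub with label set X is
  replaced by one with finitely many labels in X and the label n. If n is in X, then every finite
  part of the copy built before n is enumerated into X also embeds into the first structure. So n
  lies outside of X if and only if M changes its mind on this copy before n is enumerated.
*)

theory Submission
  imports Defs "HOL-Combinatorics.Transposition"
begin

section \<open>Total recursive functions\<close>

abbreviation ppair :: "nat \<Rightarrow> nat \<Rightarrow> nat" ("\<langle>_,/ _\<rangle>") where
  "\<langle>a, b\<rangle> \<equiv> prod_encode (a, b)"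

abbreviation pfst :: "nat \<Rightarrow> nat" where "pfst z \<equiv> fst (prod_decode z)"
abbreviation psnd :: "nat \<Rightarrow> nat" where "psnd z \<equiv> snd (prod_decode z)"

definition total_rec :: "(nat \<Rightarrow> nat) \<Rightarrow> bool" where
  "total_rec f \<longleftrightarrow> partial_recursive (\<lambda>x. Some (f x))"

definition decidable :: "(nat \<Rightarrow> bool) \<Rightarrow> bool" where
  "decidable P \<longleftrightarrow> total_rec (\<lambda>x. if P x then 1 else 0)"

named_theorems rec_intros

lemma total_rec_comp:
  assumes "total_rec f" "total_rec g" shows "total_rec (\<lambda>x. f (g x))"
  using partial_recursive.comp[of "\<lambda>x. Some (f x)" "\<lambda>x. Some (g x)"] assms
  by (simp add: total_rec_def)

lemma decidable_comp:
  assumes "decidable P" "total_rec g" shows "decidable (\<lambda>x. P (g x))"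
  using total_rec_comp[of "\<lambda>x. if P x then 1 else 0" g] assms
  by (simp add: decidable_def)

lemma total_rec_pair [rec_intros]:
  assumes "total_rec f" "total_rec g" shows "total_rec (\<lambda>x. \<langle>f x, g x\<rangle>)"
  using partial_recursive.pair[of "\<lambda>x. Some (f x)" "\<lambda>x. Some (g x)"] assms
  by (simp add: total_rec_def)

lemma total_rec_Suc [rec_intros]: "total_rec f \<Longrightarrow> total_rec (\<lambda>x. Suc (f x))"
  by (rule total_rec_comp[of Suc]) (simp_all add: total_rec_def partial_recursive.succ)

lemma total_rec_pfst [rec_intros]: "total_rec f \<Longrightarrow> total_rec (\<lambda>x. pfst (f x))"
  by (rule total_rec_comp[of pfst]) (simp_all add: total_rec_def partial_recursive.left)

lemma total_rec_psnd [rec_intros]: "total_rec f \<Longrightarrow> total_rec (\<lambda>x. psnd (f x))"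
  by (rule total_rec_comp[of psnd]) (simp_all add: total_rec_def partial_recursive.right)

text \<open>The identity is not a basic function; pairing the two projections of a number gives the
  number back.\<close>

lemma total_rec_id [rec_intros]: "total_rec (\<lambda>x. x)"
proof -
  have "total_rec pfst" "total_rec psnd"
    by (simp_all add: total_rec_def partial_recursive.left partial_recursive.right)
  then show ?thesis
    using total_rec_pair[of pfst psnd] by simp
qed

lemma total_rec_const [rec_intros]: "total_rec (\<lambda>x. n)"
  by (induction n) (simp_all add: total_rec_def partial_recursive.zero total_rec_Suc[unfolded total_rec_def])

lemma total_rec_rec_nat:
  assumes "total_rec f" "total_rec n"
    and g: "total_rec (\<lambda>z. g (pfst z) (pfst (psnd z)) (psnd (psnd z)))"
  shows "total_rec (\<lambda>x. rec_nat (f x) (g x) (n x))"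
proof -
  let ?g = "\<lambda>z. g (pfst z) (pfst (psnd z)) (psnd (psnd z))"
  have bind: "rec_nat (Some (f a)) (\<lambda>k r. Option.bind r (\<lambda>v. Some (g a k v))) m
      = Some (rec_nat (f a) (g a) m)" for a m
    by (induction m) auto
  have "total_rec (\<lambda>x. rec_nat (f (pfst x)) (g (pfst x)) (psnd x))"
    using partial_recursive.prec[of "\<lambda>x. Some (f x)" "\<lambda>x. Some (?g x)"] assms
    by (simp add: total_rec_def bind split_beta)
  from total_rec_comp[OF this total_rec_pair[OF total_rec_id assms(2)]] show ?thesis
    by simp
qed

text \<open>A conditional is a recursion of length 0 or 1: it starts with the else branch, and a
  single round overwrites it.\<close>

lemma total_rec_if [rec_intros]:
  assumes "decidable P" "total_rec f" "total_rec g"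
  shows "total_rec (\<lambda>x. if P x then f x else g x)"
proof -
  have "total_rec (\<lambda>x. rec_nat (g x) (\<lambda>k r. f x) (if P x then 1 else 0))"
    by (intro total_rec_rec_nat assms(3) assms(1)[unfolded decidable_def]
        total_rec_comp[OF assms(2)] total_rec_pfst total_rec_id)
  moreover have "(\<lambda>x. rec_nat (g x) (\<lambda>k r. f x) (if P x then 1 else 0))
      = (\<lambda>x. if P x then f x else g x)"
    by auto
  ultimately show ?thesis by simp
qed

lemma total_rec_add [rec_intros]:
  assumes "total_rec f" "total_rec g" shows "total_rec (\<lambda>x. f x + g x)"
proof -
  have "rec_nat a (\<lambda>k. Suc) b = a + b" for a b by (induction b) auto
  with total_rec_rec_nat[of f g "\<lambda>x k. Suc"] assms show ?thesis
    by (simp add: rec_intros)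
qed

lemma total_rec_pred: "total_rec f \<Longrightarrow> total_rec (\<lambda>x. f x - Suc 0)"
proof -
  assume f: "total_rec f"
  have "rec_nat 0 (\<lambda>k r. k) a = a - Suc 0" for a :: nat by (cases a) auto
  with total_rec_rec_nat[of "\<lambda>_. 0" f "\<lambda>x k r. k"] f show ?thesis
    by (simp add: rec_intros)
qed

lemma total_rec_diff [rec_intros]:
  assumes "total_rec f" "total_rec g" shows "total_rec (\<lambda>x. f x - g x)"
proof -
  have "rec_nat a (\<lambda>k r. r - Suc 0) b = a - b" for a b by (induction b) auto
  with total_rec_rec_nat[of f g "\<lambda>x k r. r - Suc 0"] assms show ?thesis
    by (simp add: rec_intros total_rec_pred)
qed

lemma total_rec_power2 [rec_intros]:
  assumes "total_rec f" shows "total_rec (\<lambda>x. 2 ^ f x)"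
proof -
  have "rec_nat 1 (\<lambda>k r. r + r) a = (2 :: nat) ^ a" for a by (induction a) auto
  with total_rec_rec_nat[of "\<lambda>_. 1" f "\<lambda>x k r. r + r"] assms show ?thesis
    by (simp add: rec_intros)
qed

lemma total_rec_sum [rec_intros]:
  assumes "total_rec (\<lambda>z. g (pfst z) (psnd z))" "total_rec n"
  shows "total_rec (\<lambda>x. \<Sum>i\<le>n x. g x i)"
proof -
  have "rec_nat 0 (\<lambda>k r. r + g x k) (Suc m) = (\<Sum>i\<le>m. g x i)" for x m
    by (induction m) auto
  moreover have "total_rec (\<lambda>z. g (pfst z) (pfst (psnd z)))"
    using total_rec_comp[OF assms(1), of "\<lambda>z. \<langle>pfst z, pfst (psnd z)\<rangle>"]
    by (simp add: rec_intros)
  ultimately show ?thesis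
    using total_rec_rec_nat[of "\<lambda>_. 0" "\<lambda>x. Suc (n x)" "\<lambda>x k r. r + g x k"] assms
    by (simp add: rec_intros)
qed

lemma total_rec_funpow:
  assumes "total_rec f" "total_rec n" "total_rec g"
  shows "total_rec (\<lambda>x. (f ^^ n x) (g x))"
proof -
  have "rec_nat a (\<lambda>k. f) m = (f ^^ m) a" for a m by (induction m) auto
  with total_rec_rec_nat[of g n "\<lambda>x k. f"] assms show ?thesis
    by (simp add: rec_intros total_rec_comp[of f])
qed

section \<open>Decidable predicates and unbounded search\<close>

lemma decidable_eq [rec_intros]:
  assumes "total_rec f" "total_rec g" shows "decidable (\<lambda>x. f x = g x)"
proof -
  have "rec_nat 1 (\<lambda>k r. 0) ((a - b) + (b - a)) = (if a = b then 1 else 0 :: nat)" for a b :: nat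
    by (cases "(a - b) + (b - a)") auto
  with total_rec_rec_nat[of "\<lambda>_. 1" "\<lambda>x. (f x - g x) + (g x - f x)" "\<lambda>x k r. 0"] assms
  show ?thesis
    by (simp add: decidable_def rec_intros)
qed

lemma decidable_not [rec_intros]:
  assumes "decidable P" shows "decidable (\<lambda>x. \<not> P x)"
proof -
  have "(\<lambda>x. if \<not> P x then 1 else 0 :: nat) = (\<lambda>x. if P x then 0 else 1)"
    by auto
  with total_rec_if[OF assms total_rec_const total_rec_const] show ?thesis
    by (simp add: decidable_def)
qed

lemma decidable_conj [rec_intros]:
  assumes "decidable P" "decidable Q" shows "decidable (\<lambda>x. P x \<and> Q x)"
proof -
  have "(\<lambda>x. if P x \<and> Q x then 1 else 0 :: nat) = (\<lambda>x. if P x then if Q x then 1 else 0 else 0)"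
    by auto
  then show ?thesis
    using total_rec_if[of P "\<lambda>x. if Q x then 1 else 0" "\<lambda>_. 0"] assms
    by (simp add: decidable_def rec_intros)
qed

lemma decidable_disj [rec_intros]:
  assumes "decidable P" "decidable Q" shows "decidable (\<lambda>x. P x \<or> Q x)"
  using decidable_not[OF decidable_conj[OF decidable_not decidable_not, OF assms]] by simp

lemma decidable_le [rec_intros]:
  assumes "total_rec f" "total_rec g" shows "decidable (\<lambda>x. f x \<le> g x)"
  using decidable_eq[of "\<lambda>x. f x - g x" "\<lambda>_. 0"] assms by (simp add: rec_intros)

lemma decidable_less [rec_intros]:
  assumes "total_rec f" "total_rec g" shows "decidable (\<lambda>x. f x < g x)"
  using decidable_not[OF decidable_le[OF assms(2,1)]] by (simp add: not_le)

text \<open>Minimisation is applied to the characteristic function with 0 standing for truth. As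
  that function is total, the search diverges only if there is no solution.\<close>

lemma partial_recursive_search:
  assumes "decidable (\<lambda>z. P (pfst z) (psnd z))"
  obtains p where "partial_recursive p" "\<And>x. p x \<noteq> None \<longleftrightarrow> (\<exists>m. P x m)"
proof -
  let ?f = "\<lambda>z. Some (if P (pfst z) (psnd z) then 0 else Suc 0)"
  let ?p = "\<lambda>a. if \<exists>n. ?f \<langle>a, n\<rangle> = Some 0 \<and> (\<forall>m<n. \<exists>v. ?f \<langle>a, m\<rangle> = Some (Suc v))
           then Some (LEAST n. ?f \<langle>a, n\<rangle> = Some 0) else None"
  have "partial_recursive ?f"
    using total_rec_if[OF assms total_rec_const total_rec_const] by (simp only: total_rec_def)
  then have "partial_recursive ?p"
    by (rule partial_recursive.mu)
  moreover have "?p x \<noteq> None \<longleftrightarrow> (\<exists>m. P x m)" for x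
  proof
    assume "\<exists>m. P x m"
    then have "\<exists>n. P x n \<and> (\<forall>m<n. \<not> P x m)"
      using exists_least_iff[of "P x"] by simp
    then show "?p x \<noteq> None" by auto
  next
    assume "?p x \<noteq> None"
    then have "\<exists>n. ?f \<langle>x, n\<rangle> = Some 0" by (metis (no_types, lifting))
    then show "\<exists>m. P x m" by (auto split: if_splits)
  qed
  ultimately show ?thesis by (rule that)
qed


section \<open>A universal machine\<close>

text \<open>
  A configuration is a pair of a stack of instructions and a current value. The instructions with
  tags up to 7 are the clauses of \<^const>\<open>partial_recursive\<close>; the other ones are continuations
  that store intermediate data: tags 8 and 9 for pairing, 10 for primitive recursion and 11 for
  minimisation. An empty stack means that the machine has halted.
\<close>

definition push :: "nat \<Rightarrow> nat \<Rightarrow> nat" where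
  "push e S = Suc \<langle>e, S\<rangle>"

definition instr :: "nat \<Rightarrow> nat \<Rightarrow> nat \<Rightarrow> nat" where
  "instr t p q = \<langle>t, \<langle>p, q\<rangle>\<rangle>"

text \<open>In tag 10, \<open>q\<close> holds the parameter, the number of finished rounds and the
  number of rounds left. In tag 11, it holds the argument and the candidate under test; the last two
  branches catch every tag from 11 on.\<close>

definition exec :: "nat \<Rightarrow> nat \<Rightarrow> nat \<Rightarrow> nat \<Rightarrow> nat \<Rightarrow> nat" where
  "exec t p q S v =
    (if t = 0 then \<langle>S, 0\<rangle>
     else if t = 1 then \<langle>S, Suc v\<rangle>
     else if t = 2 then \<langle>S, pfst v\<rangle>
     else if t = 3 then \<langle>S, psnd v\<rangle>
     else if t = 4 then \<langle>push p (push (instr 8 q v) S), v\<rangle>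
     else if t = 5 then \<langle>push q (push p S), v\<rangle>
     else if t = 6 then \<langle>push p (push (instr 10 q \<langle>pfst v, \<langle>0, psnd v\<rangle>\<rangle>) S), pfst v\<rangle>
     else if t = 7 then \<langle>push p (push (instr 11 p \<langle>v, 0\<rangle>) S), \<langle>v, 0\<rangle>\<rangle>
     else if t = 8 then \<langle>push p (push (instr 9 0 v) S), q\<rangle>
     else if t = 9 then \<langle>S, \<langle>q, v\<rangle>\<rangle>
     else if t = 10 then
       (if psnd (psnd q) = 0 then \<langle>S, v\<rangle>
        else \<langle>push p (push (instr 10 p \<langle>pfst q, \<langle>Suc (pfst (psnd q)), psnd (psnd q) - 1\<rangle>\<rangle>) S),
              \<langle>pfst q, \<langle>pfst (psnd q), v\<rangle>\<rangle>\<rangle>)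
     else if v = 0 then \<langle>S, psnd q\<rangle>
     else \<langle>push p (push (instr 11 p \<langle>pfst q, Suc (psnd q)\<rangle>) S), \<langle>pfst q, Suc (psnd q)\<rangle>\<rangle>)"

definition mstep :: "nat \<Rightarrow> nat" where
  "mstep c =
    (if pfst c = 0 then c
     else exec (pfst (pfst (pfst c - 1))) (pfst (psnd (pfst (pfst c - 1))))
       (psnd (psnd (pfst (pfst c - 1)))) (psnd (pfst c - 1)) (psnd c))"

lemma total_rec_exec [rec_intros]:
  assumes "total_rec t" "total_rec p" "total_rec q" "total_rec S" "total_rec v"
  shows "total_rec (\<lambda>x. exec (t x) (p x) (q x) (S x) (v x))"
  unfolding exec_def push_def instr_def by (intro rec_intros assms)

lemma total_rec_mstep: "total_rec mstep"
  unfolding mstep_def[abs_def] by (intro rec_intros)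

lemma mstep_push: "mstep \<langle>push (instr t p q) S, v\<rangle> = exec t p q S v"
  by (simp add: mstep_def push_def instr_def)

lemma funpow_mstep_halted: "pfst c = 0 \<Longrightarrow> (mstep ^^ k) c = c"
  by (induction k) (simp_all add: mstep_def)

definition halts :: "nat \<Rightarrow> bool" where
  "halts c \<longleftrightarrow> (\<exists>k. pfst ((mstep ^^ k) c) = 0)"

lemma halted_mono:
  assumes "pfst ((mstep ^^ k) c) = 0" "k \<le> l" shows "pfst ((mstep ^^ l) c) = 0"
proof -
  have "(mstep ^^ l) c = (mstep ^^ (l - k)) ((mstep ^^ k) c)"
    using assms(2) by (metis comp_apply funpow_add le_add_diff_inverse2)
  then show ?thesis
    using assms(1) by (simp add: funpow_mstep_halted)
qed

section \<open>Programs as subroutines of the machine\<close>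

definition reach :: "nat \<Rightarrow> nat \<Rightarrow> bool" where
  "reach c d \<longleftrightarrow> (\<exists>k. (mstep ^^ k) c = d)"

lemma reach_refl: "reach c c"
  unfolding reach_def by (rule exI[of _ 0]) simp

lemma reach_trans [trans]: "reach c d \<Longrightarrow> reach d e \<Longrightarrow> reach c e"
  unfolding reach_def by (metis funpow_add comp_apply)

lemma reach_mstep: "reach (mstep c) d \<Longrightarrow> reach c d"
  unfolding reach_def by (metis funpow_Suc_right comp_apply)

text \<open>Runs are deterministic. If \<open>c\<close> halts before it reaches \<open>d\<close>,
  then \<open>d\<close> is halted too, because halted configurations are fixed points.\<close>

lemma halts_reach:
  assumes "reach c d" shows "halts c \<longleftrightarrow> halts d"
proof -
  obtain k where k: "(mstep ^^ k) c = d" using assms by (auto simp: reach_def)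
  have shift: "(mstep ^^ (j + k)) c = (mstep ^^ j) d" for j
    by (simp add: funpow_add k)
  show ?thesis
    unfolding halts_def using halted_mono[of _ c] shift by (metis le_add1)
qed

text \<open>The stack \<open>S\<close> below the program is arbitrary, so a program can be called as
  a subroutine with any continuation waiting. This makes the notion compositional.\<close>

definition implements :: "nat \<Rightarrow> (nat \<Rightarrow> nat option) \<Rightarrow> bool" where
  "implements e f \<longleftrightarrow> (\<forall>x S.
     case f x of None \<Rightarrow> \<not> halts \<langle>push e S, x\<rangle> | Some y \<Rightarrow> reach \<langle>push e S, x\<rangle> \<langle>S, y\<rangle>)"

lemma implements_Some: "implements e f \<Longrightarrow> f x = Some y \<Longrightarrow> reach \<langle>push e S, x\<rangle> \<langle>S, y\<rangle>"
  unfolding implements_def by (metis option.simps(5))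

lemma implements_None: "implements e f \<Longrightarrow> f x = None \<Longrightarrow> \<not> halts \<langle>push e S, x\<rangle>"
  unfolding implements_def by (metis option.simps(4))

lemma implementsI:
  assumes "\<And>x y S. f x = Some y \<Longrightarrow> reach \<langle>push e S, x\<rangle> \<langle>S, y\<rangle>"
    and "\<And>x S. f x = None \<Longrightarrow> \<not> halts \<langle>push e S, x\<rangle>"
  shows "implements e f"
  using assms by (auto simp: implements_def split: option.splits)

lemma implements_basic:
  assumes "\<And>S v. exec t 0 0 S v = \<langle>S, f v\<rangle>"
  shows "implements (instr t 0 0) (\<lambda>x. Some (f x))"
proof (rule implementsI)
  show "reach \<langle>push (instr t 0 0) S, x\<rangle> \<langle>S, y\<rangle>" if "Some (f x) = Some y" for x y S
    using that by (simp add: reach_mstep mstep_push assms reach_refl)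
qed simp

lemma implements_pair:
  assumes f: "implements e f" and g: "implements d g"
  shows "implements (instr 4 e d)
      (\<lambda>x. Option.bind (f x) (\<lambda>y. Option.bind (g x) (\<lambda>z. Some \<langle>y, z\<rangle>)))"
proof -
  let ?c = "\<lambda>S x. \<langle>push (instr 4 e d) S, x\<rangle>"
  let ?K = "\<lambda>S x. push (instr 8 d x) S"
  have 1: "reach (?c S x) \<langle>push e (?K S x), x\<rangle>" for S x
    by (rule reach_mstep) (simp add: mstep_push exec_def reach_refl)
  have 2: "reach (?c S x) \<langle>push d (push (instr 9 0 y) S), x\<rangle>" if "f x = Some y" for S x y
  proof -
    have "reach \<langle>?K S x, y\<rangle> \<langle>push d (push (instr 9 0 y) S), x\<rangle>"
      by (rule reach_mstep) (simp add: mstep_push exec_def reach_refl)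
    from reach_trans[OF reach_trans[OF 1 implements_Some[OF f that]] this] show ?thesis .
  qed
  have 3: "reach (?c S x) \<langle>S, \<langle>y, z\<rangle>\<rangle>" if "f x = Some y" "g x = Some z" for S x y z
  proof -
    have "reach \<langle>push (instr 9 0 y) S, z\<rangle> \<langle>S, \<langle>y, z\<rangle>\<rangle>"
      by (rule reach_mstep) (simp add: mstep_push exec_def reach_refl)
    from reach_trans[OF reach_trans[OF 2[OF that(1)] implements_Some[OF g that(2)]] this]
    show ?thesis .
  qed
  have 4: "\<not> halts (?c S x)" if "f x = None" for S x
    using that halts_reach[OF 1] implements_None[OF f] by simp
  have 5: "\<not> halts (?c S x)" if "f x = Some y" "g x = None" for S x y
    using that halts_reach[OF 2] implements_None[OF g] by simp
  show ?thesis
    by (rule implementsI) (auto simp: bind_eq_Some_conv 3 split: bind_splits dest: 4 5)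
qed

lemma implements_comp:
  assumes f: "implements e f" and g: "implements d g"
  shows "implements (instr 5 e d) (\<lambda>x. Option.bind (g x) f)"
proof -
  have 1: "reach \<langle>push (instr 5 e d) S, x\<rangle> \<langle>push d (push e S), x\<rangle>" for S x
    by (rule reach_mstep) (simp add: mstep_push exec_def reach_refl)
  have 2: "reach \<langle>push (instr 5 e d) S, x\<rangle> \<langle>push e S, y\<rangle>" if "g x = Some y" for S x y
    by (rule reach_trans[OF 1 implements_Some[OF g that]])
  have 3: "reach \<langle>push (instr 5 e d) S, x\<rangle> \<langle>S, z\<rangle>" if "g x = Some y" "f y = Some z" for S x y z
    by (rule reach_trans[OF 2[OF that(1)] implements_Some[OF f that(2)]])
  have 4: "\<not> halts \<langle>push (instr 5 e d) S, x\<rangle>" if "g x = None" for S x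
    using that halts_reach[OF 1] implements_None[OF g] by simp
  have 5: "\<not> halts \<langle>push (instr 5 e d) S, x\<rangle>" if "g x = Some y" "f y = None" for S x y
    using that halts_reach[OF 2] implements_None[OF f] by simp
  show ?thesis
    by (rule implementsI) (auto simp: bind_eq_Some_conv 3 split: bind_splits dest: 4 5)
qed

lemma implements_prec:
  assumes f: "implements e f" and g: "implements d g"
  shows "implements (instr 6 e d)
      (\<lambda>x. case prod_decode x of (a, n) \<Rightarrow>
         rec_nat (f a) (\<lambda>k r. Option.bind r (\<lambda>v. g \<langle>a, \<langle>k, v\<rangle>\<rangle>)) n)"
proof -
  let ?R = "\<lambda>a. rec_nat (f a) (\<lambda>k r. Option.bind r (\<lambda>v. g \<langle>a, \<langle>k, v\<rangle>\<rangle>))"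
  let ?c = "\<lambda>S a n. \<langle>push (instr 6 e d) S, \<langle>a, n\<rangle>\<rangle>"
  let ?K = "\<lambda>S a k m. push (instr 10 d \<langle>a, \<langle>k, m\<rangle>\<rangle>) S"
  have 1: "reach (?c S a n) \<langle>push e (?K S a 0 n), a\<rangle>" for S a n
    by (rule reach_mstep) (simp add: mstep_push exec_def reach_refl)
  have next_iter: "reach \<langle>?K S a k (Suc m), r\<rangle> \<langle>push d (?K S a (Suc k) m), \<langle>a, \<langle>k, r\<rangle>\<rangle>\<rangle>" for S a k m r
    by (rule reach_mstep) (simp add: mstep_push exec_def reach_refl)
  \<comment> \<open>Loop invariant: \<open>k\<close> rounds have produced \<open>r\<close>, and
    \<open>m\<close> rounds are left.\<close>
  have 2: "reach (?c S a (k + m)) \<langle>?K S a k m, r\<rangle>" if "?R a k = Some r" for S a k m r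
    using that
  proof (induction k arbitrary: m r)
    case 0
    then show ?case
      using reach_trans[OF 1 implements_Some[OF f]] by simp
  next
    case (Suc k)
    then obtain r' where r': "?R a k = Some r'" "g \<langle>a, \<langle>k, r'\<rangle>\<rangle> = Some r"
      by (auto simp: bind_eq_Some_conv)
    have "reach (?c S a (k + Suc m)) \<langle>?K S a k (Suc m), r'\<rangle>"
      by (rule Suc.IH[OF r'(1)])
    also note next_iter
    also note implements_Some[OF g r'(2)]
    finally show ?case by simp
  qed
  have 3: "reach (?c S a n) \<langle>S, r\<rangle>" if "?R a n = Some r" for S a n r
  proof -
    have "reach \<langle>?K S a n 0, r\<rangle> \<langle>S, r\<rangle>"
      by (rule reach_mstep) (simp add: mstep_push exec_def reach_refl)
    from reach_trans[OF _ this] show ?thesis using 2[OF that, of S 0] by simp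
  qed
  have 4: "\<not> halts (?c S a (k + m))" if "?R a k = None" for S a k m
    using that
  proof (induction k arbitrary: m)
    case 0
    then show ?case
      using implements_None[OF f] halts_reach[OF 1] by simp
  next
    case (Suc k)
    show ?case
    proof (cases "?R a k")
      case None
      then show ?thesis using Suc.IH[of "Suc m"] by simp
    next
      case (Some r)
      then have "g \<langle>a, \<langle>k, r\<rangle>\<rangle> = None" using Suc.prems by simp
      then have "\<not> halts \<langle>push d (?K S a (Suc k) m), \<langle>a, \<langle>k, r\<rangle>\<rangle>\<rangle>"
        by (rule implements_None[OF g])
      then show ?thesis
        using halts_reach[OF reach_trans[OF 2[OF Some, of S "Suc m"] next_iter]] by simp
    qed
  qed
  show ?thesis
  proof (rule implementsI)
    fix x y S
    obtain a n where x: "x = \<langle>a, n\<rangle>" by (metis prod_decode_inverse surj_pair)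
    show "reach \<langle>push (instr 6 e d) S, x\<rangle> \<langle>S, y\<rangle>"
      if "(case prod_decode x of (a, n) \<Rightarrow> ?R a n) = Some y"
      using 3 that by (simp add: x)
    show "\<not> halts \<langle>push (instr 6 e d) S, x\<rangle>"
      if "(case prod_decode x of (a, n) \<Rightarrow> ?R a n) = None"
      using 4[of a n S 0] that by (simp add: x)
  qed
qed

lemma implements_mu:
  assumes f: "implements e f"
  shows "implements (instr 7 e 0)
      (\<lambda>a. if \<exists>n. f \<langle>a, n\<rangle> = Some 0 \<and> (\<forall>m<n. \<exists>v. f \<langle>a, m\<rangle> = Some (Suc v))
           then Some (LEAST n. f \<langle>a, n\<rangle> = Some 0) else None)"
    (is "implements _ (\<lambda>a. if ?E a then _ else _)")
proof -
  let ?c = "\<lambda>S a. \<langle>push (instr 7 e 0) S, a\<rangle>"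
  let ?K = "\<lambda>S a i. push (instr 11 e \<langle>a, i\<rangle>) S"
  have step1: "mstep (?c S a) = \<langle>push e (?K S a 0), \<langle>a, 0\<rangle>\<rangle>" for S a
    by (simp add: mstep_push exec_def)
  have next_iter: "mstep \<langle>?K S a i, Suc v\<rangle> = \<langle>push e (?K S a (Suc i)), \<langle>a, Suc i\<rangle>\<rangle>" for S a i v
    by (simp add: mstep_push exec_def)
  \<comment> \<open>The test of candidate \<open>i\<close> starts at some time
    \<open>k \<ge> i\<close>. Plain reachability would not show that nonempty stacks occur at
    arbitrarily late times, which refutes halting when every test fails.\<close>
  have 1: "\<exists>k\<ge>i. (mstep ^^ k) (?c S a) = \<langle>push e (?K S a i), \<langle>a, i\<rangle>\<rangle>"
    if "\<forall>m<i. \<exists>v. f \<langle>a, m\<rangle> = Some (Suc v)" for S a i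
    using that
  proof (induction i)
    case 0
    show ?case by (rule exI[of _ 1]) (simp add: step1)
  next
    case (Suc i)
    then obtain k where k: "k \<ge> i" "(mstep ^^ k) (?c S a) = \<langle>push e (?K S a i), \<langle>a, i\<rangle>\<rangle>"
      by auto
    obtain v where "f \<langle>a, i\<rangle> = Some (Suc v)" using Suc.prems by auto
    then obtain j where j: "(mstep ^^ j) \<langle>push e (?K S a i), \<langle>a, i\<rangle>\<rangle> = \<langle>?K S a i, Suc v\<rangle>"
      using implements_Some[OF f] unfolding reach_def by blast
    have "(mstep ^^ (Suc (j + k))) (?c S a) = \<langle>push e (?K S a (Suc i)), \<langle>a, Suc i\<rangle>\<rangle>"
      by (simp add: funpow_add k j next_iter)
    then show ?case using k(1) by (intro exI[of _ "Suc (j + k)"]) auto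
  qed
  then have 2: "reach (?c S a) \<langle>push e (?K S a i), \<langle>a, i\<rangle>\<rangle>"
    if "\<forall>m<i. \<exists>v. f \<langle>a, m\<rangle> = Some (Suc v)" for S a i
    using that unfolding reach_def by metis
  show ?thesis
  proof (rule implementsI)
    fix a y S
    assume y: "(if ?E a then Some (LEAST n. f \<langle>a, n\<rangle> = Some 0) else None) = Some y"
    then obtain n where n: "f \<langle>a, n\<rangle> = Some 0" "\<forall>m<n. \<exists>v. f \<langle>a, m\<rangle> = Some (Suc v)"
      by (metis option.distinct(1))
    have "(LEAST n. f \<langle>a, n\<rangle> = Some 0) = n"
    proof (rule Least_equality)
      show "n \<le> m" if "f \<langle>a, m\<rangle> = Some 0" for m
        using n(2) that by (metis nat.distinct(1) not_le option.inject)
    qed (rule n(1))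
    then have "y = n" using y by (auto split: if_splits)
    have "reach (?c S a) \<langle>?K S a n, 0\<rangle>"
      by (rule reach_trans[OF 2[OF n(2)] implements_Some[OF f n(1)]])
    also have "reach \<langle>?K S a n, 0\<rangle> \<langle>S, n\<rangle>"
      by (rule reach_mstep) (simp add: mstep_push exec_def reach_refl)
    finally show "reach (?c S a) \<langle>S, y\<rangle>" using \<open>y = n\<close> by simp
  next
    fix a S
    assume "(if ?E a then Some (LEAST n. f \<langle>a, n\<rangle> = Some 0) else None) = None"
    then have none: "\<not> ?E a" by (metis option.distinct(1))
    \<comment> \<open>Either the least undefined value blocks the search, all earlier values being
      positive since \<open>?E a\<close> fails, or all values are positive and the search goes on
      forever.\<close>
    show "\<not> halts (?c S a)"
    proof (cases "\<exists>m. f \<langle>a, m\<rangle> = None")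
      case True
      define m where "m = (LEAST m. f \<langle>a, m\<rangle> = None)"
      have m: "f \<langle>a, m\<rangle> = None" unfolding m_def using True by (rule LeastI_ex)
      have "\<exists>v. f \<langle>a, i\<rangle> = Some (Suc v)" if "i < m" for i
        using that
      proof (induction i rule: less_induct)
        case (less i)
        have "f \<langle>a, i\<rangle> \<noteq> None"
          using not_less_Least[of i "\<lambda>m. f \<langle>a, m\<rangle> = None"] less.prems by (simp add: m_def)
        then obtain w where w: "f \<langle>a, i\<rangle> = Some w" by blast
        have "\<forall>j<i. \<exists>v. f \<langle>a, j\<rangle> = Some (Suc v)"
          using less.IH less.prems by (meson less_trans)
        with none w show ?case by (cases w) blast+
      qed
      then show ?thesis
        using halts_reach[OF 2] implements_None[OF f m] by blast
    next
      case False
      have all: "\<exists>v. f \<langle>a, i\<rangle> = Some (Suc v)" for i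
      proof (induction i rule: less_induct)
        case (less i)
        obtain w where w: "f \<langle>a, i\<rangle> = Some w" using False by auto
        have "\<forall>j<i. \<exists>v. f \<langle>a, j\<rangle> = Some (Suc v)" using less.IH by blast
        with none w show ?case by (cases w) blast+
      qed
      show ?thesis
      proof
        assume "halts (?c S a)"
        then obtain k where k: "pfst ((mstep ^^ k) (?c S a)) = 0" by (auto simp: halts_def)
        obtain l where "l \<ge> k" "(mstep ^^ l) (?c S a) = \<langle>push e (?K S a k), \<langle>a, k\<rangle>\<rangle>"
          using 1 all by blast
        with halted_mono[OF k] show False by (fastforce simp: push_def)
      qed
    qed
  qed
qed

lemma partial_recursive_implements: "partial_recursive f \<Longrightarrow> \<exists>e. implements e f"
proof (induction rule: partial_recursive.induct)
  case zero
  have "implements (instr 0 0 0) (\<lambda>x. Some 0)"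
    by (rule implements_basic) (simp add: exec_def)
  then show ?case ..
next
  case succ
  have "implements (instr 1 0 0) (\<lambda>x. Some (Suc x))"
    by (rule implements_basic) (simp add: exec_def)
  then show ?case ..
next
  case left
  have "implements (instr 2 0 0) (\<lambda>x. Some (pfst x))"
    by (rule implements_basic) (simp add: exec_def)
  then show ?case ..
next
  case right
  have "implements (instr 3 0 0) (\<lambda>x. Some (psnd x))"
    by (rule implements_basic) (simp add: exec_def)
  then show ?case ..
next
  case (pair f g)
  then show ?case using implements_pair by blast
next
  case (comp f g)
  then show ?case using implements_comp by blast
next
  case (prec f g)
  then show ?case using implements_prec by blast
next
  case (mu f)
  then show ?case using implements_mu by blast
qed

section \<open>The diagonal halting problem by stages\<close>

definition diag_halts :: "nat \<Rightarrow> nat \<Rightarrow> bool" where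
  "diag_halts e s \<longleftrightarrow> pfst ((mstep ^^ s) \<langle>push e 0, e\<rangle>) = 0"

lemma decidable_diag_halts:
  assumes "total_rec f" "total_rec g" shows "decidable (\<lambda>x. diag_halts (f x) (g x))"
  unfolding diag_halts_def push_def using assms
  by (intro rec_intros total_rec_funpow total_rec_mstep)

lemma diag_halts_mono: "diag_halts e s \<Longrightarrow> s \<le> t \<Longrightarrow> diag_halts e t"
  unfolding diag_halts_def by (rule halted_mono)

text \<open>Take a program \<open>e\<close> of \<open>p\<close> and run it on its own code. Hence
  the domain of \<open>p\<close> cannot be the complement of the diagonal halting set.\<close>

lemma diag_halts_domain:
  assumes "partial_recursive p" shows "\<exists>e. p e \<noteq> None \<longleftrightarrow> (\<exists>s. diag_halts e s)"
proof -
  obtain e where e: "implements e p" using partial_recursive_implements[OF assms] ..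
  have "halts \<langle>push e 0, e\<rangle>" if "p e = Some y" for y
  proof -
    have "halts \<langle>0, y\<rangle>" unfolding halts_def by (intro exI[of _ 0]) simp
    then show ?thesis using halts_reach[OF implements_Some[OF e that]] by simp
  qed
  moreover have "\<not> halts \<langle>push e 0, e\<rangle>" if "p e = None"
    using implements_None[OF e that] .
  ultimately have "p e \<noteq> None \<longleftrightarrow> halts \<langle>push e 0, e\<rangle>" by blast
  then show ?thesis by (auto simp: halts_def diag_halts_def)
qed


section \<open>Ternary structures and their labels\<close>

definition ternary :: "(nat \<Rightarrow> nat \<Rightarrow> nat \<Rightarrow> bool) \<Rightarrow> structure" where
  "ternary R = Structure UNIV (\<lambda>i. if i = 0 then {[a, b, c] | a b c. R a b c} else {})"

definition pull :: "(nat \<Rightarrow> nat \<Rightarrow> nat \<Rightarrow> bool) \<Rightarrow> (nat \<Rightarrow> nat) \<Rightarrow> nat \<Rightarrow> nat \<Rightarrow> nat \<Rightarrow> bool" where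
  "pull R h a b c \<longleftrightarrow> R (h a) (h b) (h c)"

lemma univ_ternary [simp]: "univ (ternary R) = UNIV"
  by (simp add: ternary_def)

lemma rel_ternary_0 [simp]: "[a, b, c] \<in> rel (ternary R) 0 \<longleftrightarrow> R a b c"
  by (simp add: ternary_def)

lemma omega_structure_ternary: "omega_structure [3] (ternary R)"
  by (auto simp: omega_structure_def ternary_def)

lemma iso_pull:
  assumes "bij h" shows "iso (ternary (pull R h)) (ternary R)"
  unfolding iso_def
proof (intro exI[of _ h] conjI allI ballI)
  fix i xs
  show "xs \<in> rel (ternary (pull R h)) i \<longleftrightarrow> map h xs \<in> rel (ternary R) i"
    by (auto simp: ternary_def pull_def map_eq_Cons_conv)
qed (use assms in simp)

text \<open>A finite part of a pulled back structure sees only finitely many values of the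
  bijection. This lets bijections stand for copies in the locking argument.\<close>

lemma initial_part_pull_cong:
  assumes "\<And>a b c. a \<le> m \<Longrightarrow> b \<le> m \<Longrightarrow> c \<le> m \<Longrightarrow> R (f a) (f b) (f c) \<longleftrightarrow> R' (g a) (g b) (g c)"
  shows "initial_part (ternary (pull R f)) m = initial_part (ternary (pull R' g)) m"
proof -
  have "{xs \<in> rel (ternary (pull R f)) i. set xs \<subseteq> {..m}} =
      {xs \<in> rel (ternary (pull R' g)) i. set xs \<subseteq> {..m}}" for i
    by (cases "i = 0") (auto simp: ternary_def pull_def assms)
  then show ?thesis by (simp add: initial_part_def)
qed

text \<open>
  In the structures considered below, \<open>R z z z\<close> says that \<open>z\<close> is the origin of a copy of the
  natural numbers, \<open>R z z z'\<close> for \<open>z \<noteq> z'\<close> that \<open>z'\<close> is the successor of \<open>z\<close>, and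
  \<open>R w x z\<close> that \<open>w\<close> witnesses that \<open>x\<close> has the label \<open>z\<close>.
\<close>

fun numeral_elem :: "structure \<Rightarrow> nat \<Rightarrow> nat \<Rightarrow> bool" where
  "numeral_elem S 0 z \<longleftrightarrow> [z, z, z] \<in> rel S 0"
| "numeral_elem S (Suc n) z \<longleftrightarrow> (\<exists>y. y \<noteq> z \<and> numeral_elem S n y \<and> [y, y, z] \<in> rel S 0)"

definition label :: "structure \<Rightarrow> nat \<Rightarrow> nat \<Rightarrow> bool" where
  "label S x n \<longleftrightarrow> (\<exists>w z. [w, x, z] \<in> rel S 0 \<and> numeral_elem S n z)"

text \<open>The first disjunct discards whatever is not a hub, since numbers and witnesses occur in
  first position and hubs do not. Both disjuncts are existential, so finite parts can confirm
  exclusion but never revoke it.\<close>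

definition excluded :: "nat set \<Rightarrow> structure \<Rightarrow> nat \<Rightarrow> bool" where
  "excluded Z S x \<longleftrightarrow> (\<exists>b c. [x, b, c] \<in> rel S 0) \<or> (\<exists>n. n \<notin> Z \<and> label S x n)"

lemma numeral_elem_map:
  assumes h: "bij h" "\<And>a b c. [a, b, c] \<in> rel S 0 \<longleftrightarrow> [h a, h b, h c] \<in> rel T 0"
  shows "numeral_elem S n z \<longleftrightarrow> numeral_elem T n (h z)"
proof (induction n arbitrary: z)
  case (Suc n)
  have "numeral_elem T (Suc n) (h z) \<longleftrightarrow>
      (\<exists>y. h y \<noteq> h z \<and> numeral_elem T n (h y) \<and> [h y, h y, h z] \<in> rel T 0)"
    unfolding numeral_elem.simps using bij_is_surj[OF h(1)] by (metis surjD)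
  then show ?case
    using Suc.IH h(2) bij_is_inj[OF h(1)] by (simp add: inj_eq)
qed (simp add: h(2))

lemma excluded_map:
  assumes h: "bij h" "\<And>a b c. [a, b, c] \<in> rel S 0 \<longleftrightarrow> [h a, h b, h c] \<in> rel T 0"
  shows "excluded Z S x \<longleftrightarrow> excluded Z T (h x)"
proof -
  have surj: "\<forall>y. \<exists>x. y = h x" using bij_is_surj[OF h(1)] by (auto elim: surjD)
  have "(\<exists>b c. [x, b, c] \<in> rel S 0) \<longleftrightarrow> (\<exists>b c. [h x, b, c] \<in> rel T 0)"
    unfolding h(2) using surj by metis
  moreover have "label S x n \<longleftrightarrow> label T (h x) n" for n
    unfolding label_def numeral_elem_map[OF h] h(2) using surj by metis
  ultimately show ?thesis by (simp add: excluded_def)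
qed

lemma excluded_iso:
  assumes "iso S T" "univ S = UNIV" "univ T = UNIV"
  obtains h where "bij h" "\<And>Z x. excluded Z S x \<longleftrightarrow> excluded Z T (h x)"
proof -
  obtain h where h: "bij h" "\<And>i xs. xs \<in> rel S i \<longleftrightarrow> map h xs \<in> rel T i"
    using assms by (auto simp: iso_def)
  have "[a, b, c] \<in> rel S 0 \<longleftrightarrow> [h a, h b, h c] \<in> rel T 0" for a b c
    using h(2)[of "[a, b, c]"] by simp
  from that[OF h(1) excluded_map[OF h(1) this]] show ?thesis .
qed

section \<open>Positive facts show up in finite parts\<close>

lemma eventually_rel_initial_part:
  assumes "xs \<in> rel S i" shows "\<forall>\<^sub>F m in sequentially. xs \<in> rel (initial_part S m) i"
proof (rule eventually_sequentiallyI)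
  show "xs \<in> rel (initial_part S m) i" if "m \<ge> Max (insert 0 (set xs))" for m
    using assms that by (auto simp: initial_part_def)
qed

lemma eventually_numeral_elem:
  "numeral_elem S n z \<Longrightarrow> \<forall>\<^sub>F m in sequentially. numeral_elem (initial_part S m) n z"
proof (induction n arbitrary: z)
  case (Suc n)
  then obtain y where "y \<noteq> z" "numeral_elem S n y" "[y, y, z] \<in> rel S 0" by auto
  from eventually_conj[OF Suc.IH[OF this(2)] eventually_rel_initial_part[OF this(3)]] this(1)
  show ?case by (auto elim!: eventually_mono)
qed (use eventually_rel_initial_part in auto)

lemma eventually_excluded:
  assumes "excluded Z S x" shows "\<forall>\<^sub>F m in sequentially. excluded Z (initial_part S m) x"
proof (cases "\<exists>b c. [x, b, c] \<in> rel S 0")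
  case True
  then obtain b c where "[x, b, c] \<in> rel S 0" by blast
  from eventually_rel_initial_part[OF this] show ?thesis
    by (rule eventually_mono) (auto simp: excluded_def)
next
  case False
  with assms obtain n w z where n: "n \<notin> Z" "[w, x, z] \<in> rel S 0" "numeral_elem S n z"
    by (auto simp: excluded_def label_def)
  from eventually_conj[OF eventually_rel_initial_part[OF n(2)] eventually_numeral_elem[OF n(3)]]
  show ?thesis
    unfolding excluded_def label_def by (rule eventually_mono) (use n(1) in blast)
qed

lemma numeral_elem_initial_part: "numeral_elem (initial_part S m) n z \<Longrightarrow> numeral_elem S n z"
  by (induction n arbitrary: z) (auto simp: initial_part_def)

lemma excluded_initial_part: "excluded Z (initial_part S m) x \<Longrightarrow> excluded Z S x"
proof -
  have "xs \<in> rel S 0" if "xs \<in> rel (initial_part S m) 0" for xs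
    using that by (simp add: initial_part_def)
  then show "excluded Z S x" if "excluded Z (initial_part S m) x"
    using that numeral_elem_initial_part unfolding excluded_def label_def by blast
qed


section \<open>Learnability by labels\<close>

definition first_candidate :: "nat set \<Rightarrow> structure \<Rightarrow> nat" where
  "first_candidate Z S = (LEAST i. \<not> excluded Z S i)"

lemma first_candidate_initial_part_le:
  assumes "\<not> excluded Z S i" shows "first_candidate Z (initial_part S m) \<le> i"
  unfolding first_candidate_def using assms by (intro Least_le) (metis excluded_initial_part)

text \<open>Each of the finitely many elements up to \<open>i\<close> is excluded from some stage
  on, so the candidate tends to infinity.\<close>

lemma eventually_first_candidate_gt:
  assumes "\<And>i. excluded Z S i"
  shows "\<forall>\<^sub>F m in sequentially. i < first_candidate Z (initial_part S m)"
proof -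
  have "\<forall>\<^sub>F m in sequentially. \<forall>j\<in>{..i}. excluded Z (initial_part S m) j"
    by (rule eventually_ball_finite) (simp_all add: eventually_excluded assms)
  then show ?thesis
  proof (rule eventually_mono)
    fix m assume ex: "\<forall>j\<in>{..i}. excluded Z (initial_part S m) j"
    \<comment> \<open>\<open>Suc m\<close> lies outside the finite part and occurs in none of its
      triples; thus the \<open>LEAST\<close> ranges over a nonempty set.\<close>
    have "\<not> excluded Z (initial_part S m) (Suc m)"
      by (auto simp: excluded_def label_def initial_part_def)
    then have "\<not> excluded Z (initial_part S m) (first_candidate Z (initial_part S m))"
      unfolding first_candidate_def by (rule LeastI)
    with ex show "i < first_candidate Z (initial_part S m)" by (meson atMost_iff not_le)
  qed
qed

text \<open>In copies of the first structure the candidate for \<open>X\<close> stays bounded while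
  the candidate for \<open>Y\<close> tends to infinity; in copies of the second it is the other way
  round. Comparing both candidates therefore gives the right answer in the limit.\<close>

lemma learnable_pair:
  assumes A: "\<not> excluded X (ternary RA) a" "\<And>x. excluded Y (ternary RA) x"
    and B: "\<not> excluded Y (ternary RB) b" "\<And>x. excluded X (ternary RB) x"
  shows "ternary RA \<noteq> ternary RB" "\<not> iso (ternary RA) (ternary RB)"
    "\<not> iso (ternary RB) (ternary RA)" "learnable [3] {ternary RA, ternary RB}"
proof -
  let ?A = "ternary RA" and ?B = "ternary RB"
  show neq: "?A \<noteq> ?B" using A(1) B(2) by metis
  show "\<not> iso ?A ?B"
    using A(1) B(2) excluded_iso[of ?A ?B] by (metis univ_ternary)
  show "\<not> iso ?B ?A"
    using B(1) A(2) excluded_iso[of ?B ?A] by (metis univ_ternary)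
  define M where "M F = (if first_candidate X F < first_candidate Y F then Some ?A else Some ?B)" for F
  have MA: "\<forall>\<^sub>F n in sequentially. M (initial_part S n) = Some ?A"
    if S: "univ S = UNIV" "iso S ?A" for S
  proof -
    obtain h where h: "bij h" "\<And>Z x. excluded Z S x \<longleftrightarrow> excluded Z ?A (h x)"
      using excluded_iso[OF S(2,1)] by auto
    then obtain i where i: "\<not> excluded X S i" using A(1) by (metis bij_pointE)
    have "\<forall>\<^sub>F n in sequentially. i < first_candidate Y (initial_part S n)"
      by (rule eventually_first_candidate_gt) (simp add: h(2) A(2))
    then show ?thesis
    proof (rule eventually_mono)
      fix n assume "i < first_candidate Y (initial_part S n)"
      with first_candidate_initial_part_le[OF i, of n] show "M (initial_part S n) = Some ?A"
        by (simp add: M_def)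
    qed
  qed
  have MB: "\<forall>\<^sub>F n in sequentially. M (initial_part S n) = Some ?B"
    if S: "univ S = UNIV" "iso S ?B" for S
  proof -
    obtain h where h: "bij h" "\<And>Z x. excluded Z S x \<longleftrightarrow> excluded Z ?B (h x)"
      using excluded_iso[OF S(2,1)] by auto
    then obtain i where i: "\<not> excluded Y S i" using B(1) by (metis bij_pointE)
    have "\<forall>\<^sub>F n in sequentially. i < first_candidate X (initial_part S n)"
      by (rule eventually_first_candidate_gt) (simp add: h(2) B(2))
    then show ?thesis
    proof (rule eventually_mono)
      fix n assume "i < first_candidate X (initial_part S n)"
      with first_candidate_initial_part_le[OF i, of n] show "M (initial_part S n) = Some ?B"
        by (simp add: M_def)
    qed
  qed
  have unique: "a = b" if "\<forall>\<^sub>F n in sequentially. M (initial_part S n) = a"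
      "\<forall>\<^sub>F n in sequentially. M (initial_part S n) = b" for S a b
    using eventually_happens[OF eventually_conj[OF that]] by auto
  have "learns [3] {?A, ?B} M"
    unfolding learns_def
  proof (intro conjI ballI)
    show "M \<in> observations [3] {?A, ?B} \<rightarrow> hypothesis_space {?A, ?B}"
      by (auto simp: M_def hypothesis_space_def)
    fix S C
    assume "S \<in> learning_domain [3] {?A, ?B}" and C: "C \<in> {?A, ?B}"
    then have S: "univ S = UNIV" "iso S ?A \<or> iso S ?B"
      by (auto simp: learning_domain_def omega_structure_def)
    show "(\<forall>\<^sub>F n in sequentially. M (initial_part S n) = Some C) \<longleftrightarrow> iso S C"
      using C S neq MA[OF S(1)] MB[OF S(1)] unique by (metis insertE option.inject singletonD)
  qed
  then show "learnable [3] {?A, ?B}" by (auto simp: learnable_def)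
qed


section \<open>Locking\<close>

text \<open>Without a locking condition, every finite condition could be extended to a later failure
  of \<open>P\<close>. Iterating this while filling up the range would produce a bijection along
  which \<open>P\<close> fails infinitely often.\<close>

lemma locking:
  fixes P :: "(nat \<Rightarrow> nat) \<Rightarrow> nat \<Rightarrow> bool"
  assumes conv: "\<And>h. bij h \<Longrightarrow> \<forall>\<^sub>F m in sequentially. P h m"
    and local: "\<And>f g m. (\<And>i. i \<le> m \<Longrightarrow> f i = g i) \<Longrightarrow> P f m \<longleftrightarrow> P g m"
  obtains h k where "bij h"
    "\<And>g m. bij g \<Longrightarrow> (\<And>i. i \<le> k \<Longrightarrow> g i = h i) \<Longrightarrow> m \<ge> k \<Longrightarrow> P g m"
proof -
  have "\<exists>h k. bij h \<and> (\<forall>g m. bij g \<longrightarrow> (\<forall>i\<le>k. g i = h i) \<longrightarrow> m \<ge> k \<longrightarrow> P g m)"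
  proof (rule ccontr)
    assume "\<nexists>h k. bij h \<and> (\<forall>g m. bij g \<longrightarrow> (\<forall>i\<le>k. g i = h i) \<longrightarrow> m \<ge> k \<longrightarrow> P g m)"
    then have escape: "\<exists>g m. bij g \<and> (\<forall>i\<le>k. g i = h i) \<and> m \<ge> k \<and> \<not> P g m" if "bij h" for h k
      using that by blast
    \<comment> \<open>A state is a bijection whose values up to \<open>k\<close> are frozen. The
      next state keeps them and freezes both a new failure of \<open>P\<close> and a preimage of
      \<open>n\<close>.\<close>
    let ?Q = "\<lambda>n (h :: nat \<Rightarrow> nat, k :: nat). bij h \<and> n \<le> k"
    let ?T = "\<lambda>n (h :: nat \<Rightarrow> nat, k :: nat) (h' :: nat \<Rightarrow> nat, k' :: nat). (\<forall>i\<le>k. h' i = h i) \<and> k \<le> k' \<and>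
        (\<exists>m. k \<le> m \<and> m \<le> k' \<and> \<not> P h' m) \<and> (\<exists>i\<le>k'. h' i = n)"
    have next_step: "\<exists>y. ?Q (Suc n) y \<and> ?T n x y" if "?Q n x" for n x
    proof -
      obtain h k where x: "x = (h, k)" by (cases x)
      with that obtain g m where g: "bij g" "\<forall>i\<le>k. g i = h i" "m \<ge> k" "\<not> P g m"
        using escape by blast
      obtain i where i: "g i = n" using g(1) by (metis bij_pointE)
      \<comment> \<open>Large enough to freeze the failure at \<open>m\<close> and the preimage
        \<open>i\<close> of \<open>n\<close>, and to satisfy the bound of the next state.\<close>
      let ?k = "Suc n + m + i"
      have "\<exists>m'. k \<le> m' \<and> m' \<le> ?k \<and> \<not> P g m'" using g by (intro exI[of _ m]) simp
      moreover have "\<exists>i'\<le>?k. g i' = n" using i by (intro exI[of _ i]) simp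
      ultimately show ?thesis using g x by (intro exI[of _ "(g, ?k)"]) simp
    qed
    have "\<exists>f. \<forall>n. ?Q n (f n) \<and> ?T n (f n) (f (Suc n))"
    proof (rule dependent_nat_choice)
      show "\<exists>x. ?Q 0 x" by (rule exI[of _ "(id, 0)"]) simp
    qed (rule next_step)
    then obtain f where f: "\<forall>n. ?Q n (f n) \<and> ?T n (f n) (f (Suc n))" ..
    define h k where "h n = fst (f n)" and "k n = snd (f n)" for n
    have bij: "bij (h n)" and le: "n \<le> k n" for n
      using f[rule_format, of n] by (auto simp: h_def k_def split_beta)
    have step: "\<forall>i\<le>k n. h (Suc n) i = h n i" "k n \<le> k (Suc n)"
      "\<exists>m. k n \<le> m \<and> m \<le> k (Suc n) \<and> \<not> P (h (Suc n)) m" "\<exists>i\<le>k (Suc n). h (Suc n) i = n" for n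
      using f[rule_format, of n] by (auto simp: h_def k_def split_beta)
    have agree: "h n' i = h n i \<and> k n \<le> k n'" if "n \<le> n'" "i \<le> k n" for n n' i
      using that
    proof (induction n' rule: dec_induct)
      case (step n')
      then show ?case
        using \<open>\<And>n. \<forall>i\<le>k n. h (Suc n) i = h n i\<close> \<open>\<And>n. k n \<le> k (Suc n)\<close> by (metis order_trans)
    qed simp
    \<comment> \<open>The limit of the construction: since \<open>i \<le> k i\<close>, the value at
      \<open>i\<close> is frozen from stage \<open>i\<close> on.\<close>
    define g where "g i = h i i" for i
    have g: "g i = h n i" if "i \<le> k n" for n i
      unfolding g_def using agree[of n i i] agree[of i n i] that le[of i] by (metis linear)
    have "inj g"
    proof (rule injI)
      fix i j assume "g i = g j"
      then have "h (max i j) i = h (max i j) j"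
        using g[of i "max i j"] g[of j "max i j"] le[of "max i j"] by simp
      then show "i = j" using bij by (simp add: bij_is_inj inj_eq)
    qed
    moreover have "surj g"
      unfolding surj_def using step(4) g by metis
    ultimately have "\<forall>\<^sub>F m in sequentially. P g m" by (intro conv bijI)
    then obtain N where N: "\<And>m. m \<ge> N \<Longrightarrow> P g m" by (auto simp: eventually_sequentially)
    obtain m where m: "k N \<le> m" "m \<le> k (Suc N)" "\<not> P (h (Suc N)) m" using step(3) by blast
    \<comment> \<open>The failure at \<open>m\<close> depends only on values that are already frozen
      in \<open>h (Suc N)\<close>, so the limit inherits it.\<close>
    have "P g m \<longleftrightarrow> P (h (Suc N)) m"
      by (rule local) (use g m(2) in auto)
    with N[of m] m le[of N] show False by simp
  qed
  with that show ?thesis by blast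
qed

section \<open>Computable permutations with prescribed finite part\<close>

lemma total_rec_transpose [rec_intros]:
  assumes "total_rec a" "total_rec b" "total_rec f"
  shows "total_rec (\<lambda>x. transpose (a x) (b x) (f x))"
  unfolding transpose_def by (intro rec_intros assms)

text \<open>Values are corrected one at a time by swapping the preimage \<open>j\<close> of
  \<open>g k\<close> into position \<open>k\<close>. By injectivity \<open>j \<ge> k\<close>, so
  earlier values survive the swap.\<close>

lemma total_rec_bij_extension:
  assumes "inj_on g {..<k}"
  obtains h where "bij h" "total_rec h" "\<And>i. i < k \<Longrightarrow> h i = g i"
proof -
  have "\<exists>h. bij h \<and> total_rec h \<and> (\<forall>i<k. h i = g i)"
    using assms
  proof (induction k)
    case 0
    show ?case by (intro exI[of _ "\<lambda>x. x"]) (simp add: rec_intros bij_id[unfolded id_def])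
  next
    case (Suc k)
    then obtain h where h: "bij h" "total_rec h" "\<forall>i<k. h i = g i"
      by (auto simp: inj_on_def)
    obtain j where j: "h j = g k" using h(1) by (metis bij_pointE)
    have "j \<ge> k"
    proof (rule ccontr)
      assume "\<not> k \<le> j"
      then have "g j = g k" "j < k" using h(3) j by auto
      then show False using Suc.prems by (auto simp: inj_on_def)
    qed
    then have "(h \<circ> transpose k j) i = g i" if "i < Suc k" for i
      using that h(3) j by (cases "i = k") (auto simp: transpose_def)
    moreover have "bij (h \<circ> transpose k j)"
      using h(1) by (intro bij_comp) auto
    moreover have "total_rec (h \<circ> transpose k j)"
      unfolding comp_def by (intro total_rec_comp[OF h(2)] rec_intros)
    ultimately show ?case by blast
  qed
  with that show ?thesis by blast
qed


section \<open>Worlds of hubs\<close>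

text \<open>
  The element \<open>\<langle>0, q\<rangle>\<close> is the number \<open>q\<close>, \<open>\<langle>1, h\<rangle>\<close> is a hub, and
  \<open>\<langle>h + 2, s\<rangle>\<close> is the \<open>s\<close>-th witness of the hub \<open>h\<close>, giving it the label \<open>\<Phi> h s\<close>.
\<close>

definition world :: "(nat \<Rightarrow> nat \<Rightarrow> nat) \<Rightarrow> nat \<Rightarrow> nat \<Rightarrow> nat \<Rightarrow> bool" where
  "world \<Phi> a b c \<longleftrightarrow>
     pfst a = 0 \<and> b = a \<and> pfst c = 0 \<and> (psnd c = Suc (psnd a) \<or> psnd a = 0 \<and> psnd c = 0) \<or>
     2 \<le> pfst a \<and> b = \<langle>1, pfst a - 2\<rangle> \<and> c = \<langle>0, \<Phi> (pfst a - 2) (psnd a)\<rangle>"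

lemma ppair_cases: obtains t q where "z = \<langle>t, q\<rangle>"
  by (metis prod_decode_inverse surj_pair)

lemma numeral_elem_world: "numeral_elem (ternary (world \<Phi>)) n z \<longleftrightarrow> z = \<langle>0, n\<rangle>"
proof (induction n arbitrary: z)
  case 0
  show ?case by (cases z rule: ppair_cases) (auto simp: world_def)
next
  case (Suc n)
  then show ?case by (cases z rule: ppair_cases) (auto simp: world_def)
qed

lemma excluded_world:
  "excluded Z (ternary (world \<Phi>)) \<langle>t, q\<rangle> \<longleftrightarrow> t \<noteq> 1 \<or> (\<exists>s. \<Phi> q s \<notin> Z)"
proof -
  have "(\<exists>b c. world \<Phi> \<langle>t, q\<rangle> b c) \<longleftrightarrow> t \<noteq> 1"
  proof
    assume "t \<noteq> 1"
    then have "world \<Phi> \<langle>t, q\<rangle> \<langle>0, q\<rangle> \<langle>0, Suc q\<rangle> \<or> world \<Phi> \<langle>t, q\<rangle> \<langle>1, t - 2\<rangle> \<langle>0, \<Phi> (t - 2) q\<rangle>"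
      by (auto simp: world_def)
    then show "\<exists>b c. world \<Phi> \<langle>t, q\<rangle> b c" by blast
  qed (auto simp: world_def)
  moreover have "label (ternary (world \<Phi>)) \<langle>1, q\<rangle> n \<longleftrightarrow> (\<exists>s. \<Phi> q s = n)" for n
  proof -
    have "world \<Phi> w \<langle>1, q\<rangle> \<langle>0, n\<rangle> \<longleftrightarrow> (\<exists>s. w = \<langle>q + 2, s\<rangle> \<and> \<Phi> q s = n)" for w
      by (cases w rule: ppair_cases) (auto simp: world_def)
    then show ?thesis by (auto simp: label_def numeral_elem_world)
  qed
  ultimately show ?thesis by (cases "t = 1") (auto simp: excluded_def)
qed

section \<open>Maps that move hubs and witnesses\<close>

definition hub_map :: "(nat \<Rightarrow> nat) \<Rightarrow> (nat \<Rightarrow> nat \<Rightarrow> nat) \<Rightarrow> nat \<Rightarrow> nat" where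
  "hub_map \<tau> \<sigma> z =
    (if pfst z = 0 then z
     else if pfst z = 1 then \<langle>1, \<tau> (psnd z)\<rangle>
     else \<langle>\<tau> (pfst z - 2) + 2, \<sigma> (pfst z - 2) (psnd z)\<rangle>)"

lemma hub_map_simps [simp]:
  "hub_map \<tau> \<sigma> \<langle>0, q\<rangle> = \<langle>0, q\<rangle>"
  "hub_map \<tau> \<sigma> \<langle>Suc 0, h\<rangle> = \<langle>Suc 0, \<tau> h\<rangle>"
  "hub_map \<tau> \<sigma> \<langle>Suc (Suc h), s\<rangle> = \<langle>Suc (Suc (\<tau> h)), \<sigma> h s\<rangle>"
  by (simp_all add: hub_map_def)

lemma elem_cases:
  obtains (number) q where "z = \<langle>0, q\<rangle>" | (hub) h where "z = \<langle>Suc 0, h\<rangle>"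
    | (witness) h s where "z = \<langle>Suc (Suc h), s\<rangle>"
proof -
  obtain t q where "z = \<langle>t, q\<rangle>" by (rule ppair_cases)
  then show ?thesis using that by (metis not0_implies_Suc)
qed

text \<open>For a number, truncated subtraction gives the default hub 0.\<close>

definition hub_of :: "nat \<Rightarrow> nat" where
  "hub_of z = (if pfst z = 1 then psnd z else pfst z - 2)"

text \<open>A witness is tied only to its hub and to a number, and numbers are fixed. So it suffices
  to preserve labels and to keep the hubs in play apart.\<close>

lemma world_hub_map:
  assumes "inj_on \<tau> (hub_of ` D)" "a \<in> D" "b \<in> D"
    and "\<And>h s. \<langle>Suc (Suc h), s\<rangle> \<in> D \<Longrightarrow> \<Psi> (\<tau> h) (\<sigma> h s) = \<Phi> h s"
  shows "world \<Psi> (hub_map \<tau> \<sigma> a) (hub_map \<tau> \<sigma> b) (hub_map \<tau> \<sigma> c) \<longleftrightarrow> world \<Phi> a b c"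
proof (cases a rule: elem_cases)
  case (number q)
  then show ?thesis
    by (cases b rule: elem_cases; cases c rule: elem_cases) (auto simp: world_def)
next
  case (hub h)
  then show ?thesis by (simp add: world_def)
next
  case (witness h s)
  have "\<tau> h = \<tau> h' \<longleftrightarrow> h = h'" if "b = \<langle>Suc 0, h'\<rangle>" for h'
  proof -
    have "h \<in> hub_of ` D" "h' \<in> hub_of ` D"
      using assms(2,3) witness that by (force simp: hub_of_def image_iff)+
    then show ?thesis using assms(1) by (auto simp: inj_on_def)
  qed
  then show ?thesis
    using assms(2,4) witness
    by (cases b rule: elem_cases; cases c rule: elem_cases) (auto simp: world_def)
qed

lemma inj_on_hub_map:
  assumes "inj_on \<tau> (hub_of ` D)" "\<And>h. inj (\<sigma> h)"
  shows "inj_on (hub_map \<tau> \<sigma>) D"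
proof (rule inj_onI)
  fix a b assume ab: "a \<in> D" "b \<in> D" "hub_map \<tau> \<sigma> a = hub_map \<tau> \<sigma> b"
  then have "\<tau> (hub_of a) = \<tau> (hub_of b) \<Longrightarrow> hub_of a = hub_of b"
    using assms(1) by (auto simp: inj_on_def)
  with ab(3) assms(2) show "a = b"
    by (cases a rule: elem_cases; cases b rule: elem_cases) (auto simp: hub_of_def inj_eq)
qed

lemma bij_hub_map_transpose: "bij (hub_map (transpose a b) (\<lambda>h s. s))"
proof (rule involuntory_imp_bij)
  show "hub_map (transpose a b) (\<lambda>h s. s) (hub_map (transpose a b) (\<lambda>h s. s) z) = z" for z
    by (cases z rule: elem_cases) auto
qed

lemma decidable_world:
  assumes "total_rec (\<lambda>x. \<Phi> (pfst x) (psnd x))" "total_rec a" "total_rec b" "total_rec c"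
  shows "decidable (\<lambda>x. world \<Phi> (a x) (b x) (c x))"
proof -
  have "total_rec (\<lambda>x. \<Phi> (pfst (a x) - 2) (psnd (a x)))"
    using total_rec_comp[OF assms(1), of "\<lambda>x. \<langle>pfst (a x) - 2, psnd (a x)\<rangle>"] assms(2)
    by (simp add: rec_intros)
  then show ?thesis
    unfolding world_def by (intro rec_intros assms)
qed

section \<open>Computability of diagrams and of codes of finite parts\<close>

lemma sum_encode_Inl: "sum_encode (Inl a) = a + a"
  and sum_encode_Inr: "sum_encode (Inr a) = Suc (a + a)"
  by (simp_all add: sum_encode_def)

lemma decidable_bex:
  assumes "decidable (\<lambda>z. P (pfst z) (psnd z))" "total_rec n"
  shows "decidable (\<lambda>x. \<exists>i\<le>n x. P x i)"
proof -
  have "decidable (\<lambda>x. \<not> (\<Sum>i\<le>n x. if P x i then 1 else 0) = (0 :: nat))"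
    by (intro rec_intros assms)
  moreover have "\<not> (\<Sum>i\<le>n x. if P x i then 1 else 0) = (0 :: nat) \<longleftrightarrow> (\<exists>i\<le>n x. P x i)" for x
    by auto
  ultimately show ?thesis by simp
qed

text \<open>The entries of a triple are bounded by the code of its atom, so membership in the
  diagram is a bounded search.\<close>

lemma computable_structure_ternary:
  assumes "decidable (\<lambda>z. R (pfst z) (pfst (psnd z)) (psnd (psnd z)))"
  shows "computable_structure (ternary R)"
proof -
  let ?code = "\<lambda>a b c. atom_code (Rel 0 [a, b, c])"
  have bound: "a \<le> ?code a b c" "b \<le> ?code a b c" "c \<le> ?code a b c" for a b c
  proof -
    note le_prod_encode_1[of a "Suc \<langle>b, Suc \<langle>c, 0\<rangle>\<rangle>"] le_prod_encode_2[of "Suc \<langle>b, Suc \<langle>c, 0\<rangle>\<rangle>" a]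
      le_prod_encode_1[of b "Suc \<langle>c, 0\<rangle>"] le_prod_encode_2[of "Suc \<langle>c, 0\<rangle>" b] le_prod_encode_1[of c 0]
    moreover have "Suc \<langle>a, Suc \<langle>b, Suc \<langle>c, 0\<rangle>\<rangle>\<rangle> \<le> \<langle>0, Suc \<langle>a, Suc \<langle>b, Suc \<langle>c, 0\<rangle>\<rangle>\<rangle>\<rangle>"
      by (rule le_prod_encode_2)
    ultimately show "a \<le> ?code a b c" "b \<le> ?code a b c" "c \<le> ?code a b c"
      by (simp_all add: sum_encode_Inr)
  qed
  have bound_Eq: "a \<le> atom_code (Eq a a)" for a
    using le_prod_encode_1[of a a] by (simp add: sum_encode_Inl)
  have "z \<in> atom_code ` atomic_diagram (ternary R) \<longleftrightarrow>
      (\<exists>a\<le>z. z = atom_code (Eq a a)) \<or> (\<exists>a\<le>z. \<exists>b\<le>z. \<exists>c\<le>z. R a b c \<and> z = ?code a b c)" for z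
  proof
    assume "z \<in> atom_code ` atomic_diagram (ternary R)"
    then have "(\<exists>a. z = atom_code (Eq a a)) \<or> (\<exists>a b c. R a b c \<and> z = ?code a b c)"
      by (fastforce simp: atomic_diagram_def ternary_def split: if_splits)
    then show "(\<exists>a\<le>z. z = atom_code (Eq a a)) \<or>
        (\<exists>a\<le>z. \<exists>b\<le>z. \<exists>c\<le>z. R a b c \<and> z = ?code a b c)"
      using bound bound_Eq by blast
  qed (auto simp: atomic_diagram_def ternary_def simp del: atom_code.simps)
  moreover have "decidable (\<lambda>z. (\<exists>a\<le>z. z = atom_code (Eq a a)) \<or>
      (\<exists>a\<le>z. \<exists>b\<le>z. \<exists>c\<le>z. R a b c \<and> z = ?code a b c))"
  proof -
    have "decidable (\<lambda>z. R (psnd (pfst (pfst z))) (psnd (pfst z)) (psnd z))"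
      using decidable_comp[OF assms,
          of "\<lambda>z. \<langle>psnd (pfst (pfst z)), \<langle>psnd (pfst z), psnd z\<rangle>\<rangle>"]
      by (simp add: rec_intros)
    then show ?thesis
      unfolding atom_code.simps sum_encode_Inl sum_encode_Inr list_encode.simps
      by (intro rec_intros decidable_bex)
  qed
  ultimately show ?thesis
    by (simp add: computable_structure_def computable_set_def decidable_def total_rec_def)
qed

text \<open>\<open>set_encode\<close> sums powers of two over the diagram. Nested bounded sums bring
  this into a form whose computability can be read off.\<close>

lemma structure_code_ternary:
  "structure_code (initial_part (ternary R) m) =
    (\<Sum>a\<le>m. 2 ^ atom_code (Eq a a)) +
    (\<Sum>a\<le>m. \<Sum>b\<le>m. \<Sum>c\<le>m. if R a b c then 2 ^ atom_code (Rel 0 [a, b, c]) else 0)"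
proof -
  let ?T = "{(a, b, c). a \<le> m \<and> b \<le> m \<and> c \<le> m \<and> R a b c}"
  let ?rel = "\<lambda>(a, b, c). Rel 0 [a, b, c]"
  have T: "?T = {x \<in> {..m} \<times> {..m} \<times> {..m}. case x of (a, b, c) \<Rightarrow> R a b c}" by auto
  have "?rel ` ?T = {Rel 0 [a, b, c] | a b c. a \<le> m \<and> b \<le> m \<and> c \<le> m \<and> R a b c}"
    by force
  then have "atomic_diagram (initial_part (ternary R) m) = (\<lambda>a. Eq a a) ` {..m} \<union> ?rel ` ?T"
    by (auto simp: atomic_diagram_def initial_part_def ternary_def image_iff split: if_splits)
  then have "structure_code (initial_part (ternary R) m) =
      (\<Sum>x\<in>(\<lambda>a. Eq a a) ` {..m} \<union> ?rel ` ?T. 2 ^ atom_code x)"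
    by (simp add: structure_code_def set_encode_def sum.reindex[OF inj_on_subset[OF inj_atom_code]])
  also have "\<dots> = (\<Sum>x\<in>(\<lambda>a. Eq a a) ` {..m}. 2 ^ atom_code x) + (\<Sum>x\<in>?rel ` ?T. 2 ^ atom_code x)"
  proof (rule sum.union_disjoint)
    show "finite (?rel ` ?T)" unfolding T by (intro finite_imageI) simp
  qed auto
  also have "(\<Sum>x\<in>(\<lambda>a. Eq a a) ` {..m}. 2 ^ atom_code x) = (\<Sum>a\<le>m. 2 ^ atom_code (Eq a a) :: nat)"
    by (subst sum.reindex) (auto simp: inj_on_def)
  also have "(\<Sum>x\<in>?rel ` ?T. 2 ^ atom_code x) = (\<Sum>x\<in>?T. 2 ^ atom_code (?rel x) :: nat)"
    by (subst sum.reindex) (auto simp: inj_on_def)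
  also have "\<dots> = (\<Sum>x\<in>{..m} \<times> {..m} \<times> {..m}.
      if (case x of (a, b, c) \<Rightarrow> R a b c) then 2 ^ atom_code (?rel x) else 0)"
    unfolding T by (rule sum.inter_filter) simp
  also have "\<dots> = (\<Sum>a\<le>m. \<Sum>b\<le>m. \<Sum>c\<le>m. if R a b c then 2 ^ atom_code (Rel 0 [a, b, c]) else 0)"
    unfolding sum.cartesian_product by (rule sum.cong) (auto simp del: atom_code.simps)
  finally show ?thesis .
qed

lemma total_rec_structure_code:
  assumes "decidable (\<lambda>z. R (pfst z) (pfst (psnd z)) (pfst (psnd (psnd z))) (psnd (psnd (psnd z))))"
    and "total_rec n" "total_rec m"
  shows "total_rec (\<lambda>x. structure_code (initial_part (ternary (R (n x))) (m x)))"
proof -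
  have "decidable (\<lambda>z. R (n (pfst (pfst (pfst z)))) (psnd (pfst (pfst z))) (psnd (pfst z)) (psnd z))"
    using decidable_comp[OF assms(1), of "\<lambda>z. \<langle>n (pfst (pfst (pfst z))),
        \<langle>psnd (pfst (pfst z)), \<langle>psnd (pfst z), psnd z\<rangle>\<rangle>\<rangle>"]
    by (simp add: rec_intros total_rec_comp[OF assms(2)])
  then show ?thesis
    unfolding structure_code_ternary atom_code.simps sum_encode_Inl sum_encode_Inr list_encode.simps
    by (intro rec_intros assms(3) total_rec_comp[OF assms(3)])
qed


section \<open>The pair of structures\<close>

text \<open>The shift by 2 keeps the labels 0 and 1 outside of the halting set.\<close>

definition halt_at :: "nat \<Rightarrow> nat \<Rightarrow> bool" where
  "halt_at n s \<longleftrightarrow> 2 \<le> n \<and> diag_halts (n - 2) s"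

definition halt_set :: "nat set" where
  "halt_set = {n. \<exists>s. halt_at n s}"

text \<open>The default output of \<open>enum\<close>, which keeps it total with all values in the
  halting set.\<close>

definition halt_elem :: nat where
  "halt_elem = (SOME n. n \<in> halt_set)"

text \<open>Every element of the halting set is enumerated infinitely often.\<close>

definition enum :: "nat \<Rightarrow> nat" where
  "enum s = (if halt_at (pfst s) (psnd s) then pfst s else halt_elem)"

text \<open>
  For \<open>k > 0\<close>, the hub pretends to enumerate the halting set up to stage \<open>k\<close> and then shows the
  label \<open>n\<close>, which it covers with the label 0 as soon as \<open>n\<close> turns out to be in the halting
  set. For \<open>k = 0\<close>, it pretends up to stage \<open>n\<close> to have no label but 1.
\<close>

definition decoy :: "nat \<Rightarrow> nat \<Rightarrow> nat \<Rightarrow> nat" where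
  "decoy k n s =
    (if k = 0 then (if s \<le> n then 1 else 0)
     else if s < k then enum s
     else if halt_at n s then 0 else n)"

text \<open>The successor reserves 0 for the one hub on which the two worlds differ.\<close>

definition decoy_hub :: "nat \<Rightarrow> nat \<Rightarrow> nat" where
  "decoy_hub k n = Suc \<langle>k, n\<rangle>"

definition labels_A :: "nat \<Rightarrow> nat \<Rightarrow> nat" where
  "labels_A h s = (if h = 0 then enum s else decoy (pfst (h - 1)) (psnd (h - 1)) s)"

definition labels_B :: "nat \<Rightarrow> nat \<Rightarrow> nat" where
  "labels_B h s = (if h = 0 then 1 else labels_A h s)"

abbreviation world_A :: "nat \<Rightarrow> nat \<Rightarrow> nat \<Rightarrow> bool" where "world_A \<equiv> world labels_A"
abbreviation world_B :: "nat \<Rightarrow> nat \<Rightarrow> nat \<Rightarrow> bool" where "world_B \<equiv> world labels_B"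

lemma labels_decoy_hub [simp]:
  "labels_A (decoy_hub k n) s = decoy k n s" "labels_B (decoy_hub k n) s = decoy k n s"
  by (simp_all add: labels_A_def labels_B_def decoy_hub_def)

lemma hub_cases:
  obtains "h = 0" | k n where "h = decoy_hub k n"
proof (cases h)
  case (Suc h')
  obtain k n where "h' = \<langle>k, n\<rangle>" by (rule ppair_cases)
  with that(2) Suc show ?thesis by (simp add: decoy_hub_def)
qed (rule that(1))

lemma halt_at_mono: "halt_at n s \<Longrightarrow> s \<le> t \<Longrightarrow> halt_at n t"
  by (auto simp: halt_at_def intro: diag_halts_mono)

lemma decidable_halt_at [rec_intros]:
  "total_rec f \<Longrightarrow> total_rec g \<Longrightarrow> decidable (\<lambda>x. halt_at (f x) (g x))"
  unfolding halt_at_def by (intro rec_intros decidable_diag_halts)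

lemma halt_set_gt: "n \<in> halt_set \<Longrightarrow> n > 1"
  by (auto simp: halt_set_def halt_at_def)

lemma halt_elem: "halt_elem \<in> halt_set"
proof -
  obtain e s where "diag_halts e s"
    using diag_halts_domain[OF partial_recursive.zero] by auto
  then have "e + 2 \<in> halt_set" by (auto simp: halt_set_def halt_at_def)
  then show ?thesis unfolding halt_elem_def by (rule someI)
qed

lemma enum_halt_set: "enum s \<in> halt_set"
  using halt_elem by (auto simp: enum_def halt_set_def)

text \<open>The complement of the halting set is not c.e.: diagonalise against \<open>p\<close>
  composed with the shift by 2.\<close>

lemma not_computable_halt_set:
  assumes "partial_recursive p" shows "\<exists>n. \<not> (p n \<noteq> None \<longleftrightarrow> n \<notin> halt_set)"
proof -
  have "partial_recursive (\<lambda>x. Option.bind (Some (x + 2)) p)"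
    using total_rec_add[OF total_rec_id total_rec_const, of 2] assms
    by (intro partial_recursive.comp) (simp_all add: total_rec_def)
  then obtain e where "p (e + 2) \<noteq> None \<longleftrightarrow> (\<exists>s. diag_halts e s)"
    using diag_halts_domain by fastforce
  moreover have "e + 2 \<in> halt_set \<longleftrightarrow> (\<exists>s. diag_halts e s)"
    by (simp add: halt_set_def halt_at_def)
  ultimately show ?thesis by blast
qed

lemma decidable_world_A:
  assumes "total_rec a" "total_rec b" "total_rec c"
  shows "decidable (\<lambda>x. world_A (a x) (b x) (c x))"
  by (rule decidable_world[OF _ assms], unfold labels_A_def decoy_def enum_def) (intro rec_intros)

lemma decidable_world_B:
  assumes "total_rec a" "total_rec b" "total_rec c"
  shows "decidable (\<lambda>x. world_B (a x) (b x) (c x))"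
  by (rule decidable_world[OF _ assms], unfold labels_B_def labels_A_def decoy_def enum_def)
    (intro rec_intros)

text \<open>The offending label is 1 if \<open>k = 0\<close>. Otherwise it is the covering label 0
  if \<open>n\<close> is enumerated, and \<open>n\<close> itself if not.\<close>

lemma decoy_not_subset_halt_set: "\<exists>s. decoy k n s \<notin> halt_set"
proof (cases "k = 0")
  case True
  then have "decoy k n 0 = 1" by (simp add: decoy_def)
  then show ?thesis using halt_set_gt by (metis less_irrefl)
next
  case False
  show ?thesis
  proof (cases "n \<in> halt_set")
    case True
    then obtain t where "halt_at n t" by (auto simp: halt_set_def)
    then have "decoy k n (k + t) = 0" using False halt_at_mono by (auto simp: decoy_def)
    then show ?thesis using halt_set_gt by (metis not_less_zero)
  next
    case n: False
    then have "decoy k n k = n" using False by (auto simp: decoy_def halt_set_def)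
    with n show ?thesis by metis
  qed
qed

lemma decoy_neq_1: "\<exists>s. decoy k n s \<noteq> 1"
proof (cases "k = 0")
  case True
  then have "decoy k n (Suc n) = 0" by (simp add: decoy_def)
  then show ?thesis by (metis zero_neq_one)
next
  case False
  then have "decoy k n 0 \<in> halt_set" using enum_halt_set by (simp add: decoy_def)
  then show ?thesis using halt_set_gt by (metis less_irrefl)
qed

lemma excluded_world_A: "excluded {1} (ternary world_A) x"
proof (cases x rule: ppair_cases)
  case (1 t q)
  have "\<exists>s. labels_A q s \<noteq> 1"
  proof (cases q rule: hub_cases)
    case 1
    then have "labels_A q 0 \<in> halt_set" by (simp add: labels_A_def enum_halt_set)
    then show ?thesis using halt_set_gt by (metis less_irrefl)
  qed (simp add: decoy_neq_1[simplified])
  then show ?thesis using 1 by (simp add: excluded_world)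
qed

lemma excluded_world_B: "excluded halt_set (ternary world_B) x"
proof (cases x rule: ppair_cases)
  case (1 t q)
  have "\<exists>s. labels_B q s \<notin> halt_set"
  proof (cases q rule: hub_cases)
    case 1
    then show ?thesis using halt_set_gt by (auto simp: labels_B_def)
  qed (simp add: decoy_not_subset_halt_set)
  then show ?thesis using 1 by (simp add: excluded_world)
qed

lemma not_excluded_world_A: "\<not> excluded halt_set (ternary world_A) \<langle>1, 0\<rangle>"
  by (simp add: excluded_world labels_A_def enum_halt_set del: One_nat_def)

lemma not_excluded_world_B: "\<not> excluded {1} (ternary world_B) \<langle>1, 0\<rangle>"
  by (simp add: excluded_world labels_B_def del: One_nat_def)

lemmas learnable_worlds =
  learnable_pair[OF not_excluded_world_A excluded_world_A not_excluded_world_B excluded_world_B]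

lemma computable_family_worlds: "computable_family [3] {ternary world_A, ternary world_B}"
proof -
  have "computable_structure (ternary world_A)" "computable_structure (ternary world_B)"
    by (intro computable_structure_ternary decidable_world_A decidable_world_B rec_intros)+
  then show ?thesis
    using learnable_worlds(2,3) by (auto simp: computable_family_def omega_structure_ternary)
qed


section \<open>Defeating computable learners\<close>

text \<open>
  A copy of the second structure in which the hub 0, which enumerates the halting set in the first
  structure, is played by a decoy for \<open>n\<close>.
\<close>

definition impostor :: "nat \<Rightarrow> (nat \<Rightarrow> nat) \<Rightarrow> nat \<Rightarrow> nat \<Rightarrow> nat" where
  "impostor K d n i = hub_map (transpose 0 (decoy_hub K n)) (\<lambda>h s. s) (d i)"

lemma bij_impostor: "bij d \<Longrightarrow> bij (impostor K d n)"
  using bij_comp[OF _ bij_hub_map_transpose] by (simp add: impostor_def[abs_def] comp_def)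

lemma total_rec_impostor:
  assumes d: "total_rec d" and "total_rec n" "total_rec i"
  shows "total_rec (\<lambda>x. impostor K d (n x) (i x))"
  unfolding impostor_def hub_map_def decoy_hub_def
  by (intro rec_intros assms(2) total_rec_comp[OF d assms(3)])

text \<open>Inside the first world the decoy is sent to hub 0, its late witnesses of
  \<open>n\<close> going to true stages at which \<open>n\<close> is enumerated. The hub with label
  1 is sent to a decoy that shows only 1 for long enough.\<close>

lemma impostor_embeds:
  fixes d :: "nat \<Rightarrow> nat"
  assumes d: "bij d" "\<And>i. i \<le> k \<Longrightarrow> d i < K" and b: "\<And>i. i \<le> m \<Longrightarrow> d i \<le> b"
    and n: "n \<in> halt_set" "\<not> halt_at n b"
  obtains g where "inj_on g {..m}" "\<And>i. i \<le> k \<Longrightarrow> g i = d i"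
    "\<And>x y z. x \<le> m \<Longrightarrow> y \<le> m \<Longrightarrow> z \<le> m \<Longrightarrow> world_A (g x) (g y) (g z) \<longleftrightarrow>
       world_B (impostor K d n x) (impostor K d n y) (impostor K d n z)"
proof -
  define H where "H = decoy_hub K n"
  \<comment> \<open>A bound on all hubs and stages that the finite part can mention. The decoy hub
    \<open>H'\<close> lies above it, hence is fresh, and shows 1 at all visible stages.\<close>
  define b' where "b' = H + b"
  define H' where "H' = decoy_hub 0 b'"
  have "K \<le> \<langle>K, n\<rangle>" by (rule le_prod_encode_1)
  then have H: "K < H" by (simp add: H_def decoy_hub_def)
  have "b' \<le> \<langle>0, b'\<rangle>" by (rule le_prod_encode_2)
  then have H': "b' < H'" by (simp add: H'_def decoy_hub_def)
  obtain t where t: "halt_at n t" using n(1) by (auto simp: halt_set_def)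
  have K: "K > 0" using d(2)[of 0] by simp
  \<comment> \<open>Infinitely many stages enumerate \<open>n\<close>, so its witnesses get distinct
    targets. Adding \<open>K\<close> keeps them away from the early stages, which
    \<open>\<sigma>\<close> fixes.\<close>
  define r where "r s = \<langle>n, t + K + s\<rangle>" for s
  have r: "K \<le> r s" "enum (r s) = n" for s
    using le_prod_encode_2[of "t + K + s" n] halt_at_mono[OF t, of "t + K + s"]
    by (simp_all add: r_def enum_def)
  define \<tau> where "\<tau> h = (if h = 0 then H' else if h = H then 0 else h)" for h
  define \<sigma> where "\<sigma> h s = (if h = H \<and> K \<le> s then r s else s)" for h s
  let ?L = "impostor K d n" and ?E = "hub_map \<tau> \<sigma>"
  let ?D = "?L ` {..m}"
  have coords: "h \<le> b'" "s \<le> b" if "\<langle>Suc (Suc h), s\<rangle> = ?L i" "i \<le> m" for h s i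
  proof -
    have "pfst (d i) \<le> b" "psnd (d i) \<le> b"
      using b[OF that(2)] le_prod_encode_1[of "pfst (d i)" "psnd (d i)"]
        le_prod_encode_2[of "psnd (d i)" "pfst (d i)"] by auto
    then show "h \<le> b'" "s \<le> b"
      using that(1) unfolding impostor_def H_def[symmetric]
      by (cases "d i" rule: elem_cases; auto simp: b'_def transpose_def split: if_splits)+
  qed
  have hub_of: "hub_of z \<le> b'" if "z \<in> ?D" for z
  proof -
    from that obtain i where i: "i \<le> m" "z = ?L i" by auto
    have "pfst (d i) \<le> b" "psnd (d i) \<le> b"
      using b[OF i(1)] le_prod_encode_1[of "pfst (d i)" "psnd (d i)"]
        le_prod_encode_2[of "psnd (d i)" "pfst (d i)"] by auto
    then show ?thesis
      using i(2) unfolding impostor_def H_def[symmetric]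
      by (cases "d i" rule: elem_cases) (auto simp: b'_def hub_of_def transpose_def)
  qed
  have \<tau>: "inj_on \<tau> (hub_of ` ?D)"
  proof (rule inj_on_subset)
    show "inj_on \<tau> {..b'}"
      using H' by (auto simp: inj_on_def \<tau>_def)
  qed (use hub_of in auto)
  have \<sigma>: "inj (\<sigma> h)" for h
  proof (rule injI)
    fix s s' assume "\<sigma> h s = \<sigma> h s'"
    then show "s = s'" using r(1)[of s] r(1)[of s'] by (auto simp: \<sigma>_def r_def split: if_splits)
  qed
  have labels: "labels_A (\<tau> h) (\<sigma> h s) = labels_B h s" if "\<langle>Suc (Suc h), s\<rangle> \<in> ?D" for h s
  proof -
    have le: "s \<le> b" using that coords by blast
    consider "h = 0" | "h = H" "h \<noteq> 0" | "h \<noteq> 0" "h \<noteq> H" by blast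
    then show ?thesis
    proof cases
      case 1
      then have "labels_A (\<tau> h) (\<sigma> h s) = decoy 0 b' s"
        using H by (simp add: \<tau>_def \<sigma>_def H'_def)
      then show ?thesis using 1 le by (simp add: decoy_def b'_def labels_B_def)
    next
      case 2
      have "\<not> halt_at n s" using n(2) le halt_at_mono by blast
      then have "labels_B h s = (if s < K then enum s else n)"
        using 2 K by (simp add: H_def decoy_def)
      then show ?thesis using 2 r(2) by (simp add: labels_A_def \<tau>_def \<sigma>_def)
    next
      case 3
      then show ?thesis by (simp add: \<tau>_def \<sigma>_def labels_B_def)
    qed
  qed
  show ?thesis
  proof (rule that)
    have "inj_on ?E ?D" by (rule inj_on_hub_map[OF \<tau> \<sigma>])
    moreover have "inj_on ?L {..m}"
      using bij_impostor[OF d(1)] by (auto simp: bij_def intro: inj_on_subset)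
    ultimately show "inj_on (?E \<circ> ?L) {..m}" by (rule comp_inj_on[rotated])
    \<comment> \<open>Locked elements lie below \<open>K < H\<close>, so they involve neither hub
      \<open>H\<close> nor stages from \<open>K\<close> on: hub 0 goes to \<open>H\<close> and back,
      and all else stays.\<close>
    show "(?E \<circ> ?L) i = d i" if "i \<le> k" for i
    proof -
      have "pfst (d i) < K" "psnd (d i) < K"
        using d(2)[OF that] le_prod_encode_1[of "pfst (d i)" "psnd (d i)"]
          le_prod_encode_2[of "psnd (d i)" "pfst (d i)"] by auto
      then show ?thesis
        using H unfolding impostor_def H_def[symmetric] comp_def
        by (cases "d i" rule: elem_cases) (auto simp: transpose_def \<tau>_def \<sigma>_def)
    qed
    show "world_A ((?E \<circ> ?L) x) ((?E \<circ> ?L) y) ((?E \<circ> ?L) z) \<longleftrightarrow> world_B (?L x) (?L y) (?L z)"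
      if "x \<le> m" "y \<le> m" "z \<le> m" for x y z
      unfolding comp_def by (rule world_hub_map[OF \<tau>]) (use that labels in auto)
  qed
qed

lemma not_computably_learnable_worlds:
  "\<not> computably_learnable [3] {ternary world_A, ternary world_B}"
proof
  let ?A = "ternary world_A" and ?B = "ternary world_B"
  let ?K = "{?A, ?B}"
  assume "computably_learnable [3] ?K"
  then obtain M p c where M: "learns [3] ?K M" and p: "partial_recursive p"
    and c: "inj_on c (hypothesis_space ?K)"
    and pM: "\<And>F. F \<in> observations [3] ?K \<Longrightarrow> p (structure_code F) = Some (c (M F) :: nat)"
    by (auto simp: computably_learnable_def computable_learner_def)
  have copy_A: "ternary (pull world_A h) \<in> learning_domain [3] ?K" if "bij h" for h
    using iso_pull[OF that] by (auto simp: learning_domain_def omega_structure_ternary)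
  have copy_B: "ternary (pull world_B h) \<in> learning_domain [3] ?K" if "bij h" for h
    using iso_pull[OF that] by (auto simp: learning_domain_def omega_structure_ternary)
  let ?P = "\<lambda>h m. M (initial_part (ternary (pull world_A h)) m) = Some ?A"
  obtain h k where h: "bij h"
    and lock: "\<And>g m. bij g \<Longrightarrow> (\<And>i. i \<le> k \<Longrightarrow> g i = h i) \<Longrightarrow> m \<ge> k \<Longrightarrow> ?P g m"
  proof (rule locking[of ?P])
    show "\<forall>\<^sub>F m in sequentially. ?P h m" if "bij h" for h
      using M copy_A[OF that] iso_pull[OF that] by (auto simp: learns_def)
    show "?P f m \<longleftrightarrow> ?P g m" if "\<And>i. i \<le> m \<Longrightarrow> f i = g i" for f g m
      using initial_part_pull_cong[of m world_A f world_A g] that by simp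
  qed blast
  \<comment> \<open>The locking bijection may be noncomputable, but only its finite part matters;
    \<open>d\<close> is a computable bijection sharing it.\<close>
  obtain d where d: "bij d" "total_rec d" "\<And>i. i < Suc k \<Longrightarrow> d i = h i"
    using total_rec_bij_extension[of h "Suc k"] h by (metis bij_is_inj inj_on_subset subset_UNIV)
  \<comment> \<open>Beyond all locked elements, and thus beyond the hubs and stages coded in
    them.\<close>
  define K where "K = Suc (\<Sum>i\<le>k. d i)"
  have K: "d i < K" if "i \<le> k" for i
    using member_le_sum[of i "{..k}" d] that by (simp add: K_def less_Suc_eq_le)
  define b where "b m = (\<Sum>i\<le>m. d i)" for m
  have b: "d i \<le> b m" if "i \<le> m" for i m
    using member_le_sum[of i "{..m}" d] that by (simp add: b_def)
  define F where "F n m = initial_part (ternary (pull world_B (impostor K d n))) m" for n m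
  have F: "F n m \<in> observations [3] ?K" for n m
    using copy_B[OF bij_impostor[OF d(1)]] by (auto simp: F_def observations_def)
  let ?v = "\<lambda>z. c (M (F (pfst z) (k + psnd z)))"
  have "total_rec (\<lambda>z. structure_code (F (pfst z) (k + psnd z)))"
    unfolding F_def
    by (rule total_rec_structure_code, unfold pull_def)
      (intro decidable_world_B total_rec_impostor[OF d(2)] rec_intros)+
  then have "partial_recursive (\<lambda>z. Option.bind (Some (structure_code (F (pfst z) (k + psnd z)))) p)"
    unfolding total_rec_def by (rule partial_recursive.comp[OF p])
  \<comment> \<open>Every \<open>F n m\<close> is part of a copy in the learning domain, so
    \<open>p\<close> converges on its code.\<close>
  then have v: "total_rec ?v"
    by (simp add: total_rec_def pM[OF F])
  \<comment> \<open>The search looks for a wrong guess on a part for which \<open>n\<close> is not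
    yet enumerated at a stage bounding all \<open>d i\<close> in that part.\<close>
  have "decidable (\<lambda>z. ?v z \<noteq> c (Some ?A) \<and> \<not> halt_at (pfst z) (b (k + psnd z)))"
    unfolding b_def by (intro rec_intros v total_rec_comp[OF d(2)])
  then obtain q where "partial_recursive q"
    and q: "\<And>n. q n \<noteq> None \<longleftrightarrow>
      (\<exists>m. c (M (F n (k + m))) \<noteq> c (Some ?A) \<and> \<not> halt_at n (b (k + m)))"
    by (rule partial_recursive_search) blast
  have "q n \<noteq> None \<longleftrightarrow> n \<notin> halt_set" for n
  proof
    assume "q n \<noteq> None"
    then obtain m where m: "M (F n (k + m)) \<noteq> Some ?A" "\<not> halt_at n (b (k + m))"
      using q by metis
    show "n \<notin> halt_set"
    proof
      assume "n \<in> halt_set"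
      \<comment> \<open>The part also embeds into the first world and respects the lock. Extended to
        a bijection, the embedding forces the very conjecture that was found missing.\<close>
      then obtain g where g: "inj_on g {..k + m}" "\<And>i. i \<le> k \<Longrightarrow> g i = d i"
        "\<And>x y z. x \<le> k + m \<Longrightarrow> y \<le> k + m \<Longrightarrow> z \<le> k + m \<Longrightarrow> world_A (g x) (g y) (g z) \<longleftrightarrow>
           world_B (impostor K d n x) (impostor K d n y) (impostor K d n z)"
        using impostor_embeds[OF d(1) K b _ m(2)] by blast
      obtain f where f: "bij f" "\<And>i. i < Suc (k + m) \<Longrightarrow> f i = g i"
        using total_rec_bij_extension[of g "Suc (k + m)"] g(1) by (metis lessThan_Suc_atMost)
      have "F n (k + m) = initial_part (ternary (pull world_A f)) (k + m)"
        unfolding F_def by (rule initial_part_pull_cong) (simp add: f(2) g(3))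
      moreover have "?P f (k + m)"
        by (rule lock) (simp_all add: f g(2) d(3))
      ultimately show False using m(1) by simp
    qed
  next
    assume n: "n \<notin> halt_set"
    \<comment> \<open>These are the parts of one copy of the second structure, so the learner must
      settle on it, while the stage condition holds throughout because \<open>n\<close> is never
      enumerated.\<close>
    have "\<forall>\<^sub>F m in sequentially. M (F n m) = Some ?B"
      unfolding F_def
      using M copy_B[OF bij_impostor[OF d(1)]] iso_pull[OF bij_impostor[OF d(1)]]
      by (auto simp: learns_def)
    then obtain m where "M (F n (k + m)) = Some ?B"
      by (auto simp: eventually_sequentially) (metis le_add2)
    moreover have "c (Some ?B) \<noteq> c (Some ?A)"
      using c learnable_worlds(1) by (auto simp: inj_on_def hypothesis_space_def)
    ultimately show "q n \<noteq> None"
      using n q by (metis (mono_tags, lifting) halt_set_def mem_Collect_eq)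
  qed
  with not_computable_halt_set[OF \<open>partial_recursive q\<close>] show False by blast
qed

theorem theorem4p1:
  shows "\<exists>(sig :: signature) (K :: structure set).
    computable_family sig K \<and> card K = 2 \<and>
    learnable sig K \<and> \<not> computably_learnable sig K"
proof (intro exI conjI)
  show "computable_family [3] {ternary world_A, ternary world_B}"
    by (rule computable_family_worlds)
  show "card {ternary world_A, ternary world_B} = 2"
    using learnable_worlds(1) by simp
  show "learnable [3] {ternary world_A, ternary world_B}"
    by (rule learnable_worlds(4))
  show "\<not> computably_learnable [3] {ternary world_A, ternary world_B}"
    by (rule not_computably_learnable_worlds)
qed

end
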